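(* Consider a discrete memoryless one-hop network with $N_{\rm TX}$ transmitters, $N_{\rm RX}$ receivers, transition probability $P_{Y_1\ldots Y_{N_{\rm RX}}|X_1\ldots X_{N_{\rm TX}}}$ and message allocation $V$, and let $(V,S)$ be a superposition coding graph on $V$ (both as defined in the context), with no binning being employed. Let $Q$ and $\{U_{i\to j},\ (i,j)\in V\}$ be finite-alphabet random variables whose joint distribution factors as $$P_Q\prod_{(i,j)\in V}P_{U_{i\to j}\,|\,\mathrm{pa}_S(U_{i\to j}),\,Q},$$ and for each $k\in\{1,\dots,N_{\rm TX}\}$ let $X_k$ be any deterministic function of $\big(\{U_{i\to j}: (i,j)\in V,\ k\in i\},\,Q\big)$; let $Y_1,\dots,Y_{N_{\rm RX}}$ be the channel outputs obtained by passing $X_1,\ldots,X_{N_{\rm TX}}$ through the channel. For each receiver $z$ let $V^z=\{(i,j)\in V:\ z\in j\}$. Let $\mathcal R$ be the set of nonnegative rate vectors $(R_{i\to j})_{(i,j)\in V}$ such that $$\sum_{(i,j)\in \overline F^z} R_{i\to j}\ \le\ I\big(Y_z;\ \{U_{i\to j}: (i,j)\in \overline F^z\}\ \big|\ \{U_{i\to j}: (i,j)\in F^z\},\,Q\big)$$ for every $z\in\{1,\dots,N_{\rm RX}\}$ and every subset $F^z\subseteq V^z$ satisfying $\mathrm{pa}_S(F^z)\subseteq F^z$ (this includes the case $\mathrm{pa}_S(F^z)=\emptyset$), where $\overline F^z=V^z\setminus F^z$. Then $\mathcal R$ is achievable, i.e. $\mathcal R$ is contained in the capacity region of the network with message allocation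 $V$.
   Context: Network. All input and output alphabets are finite. Encoder $k\in\{1,\dots,N_{\rm TX}\}$ has channel input $X_k$, receiver $z\in\{1,\dots,N_{\rm RX}\}$ observes $Y_z$, the channel is memoryless with the given transition probability, and there is no feedback or cooperation. The message allocation $V$ is a finite set of distinct pairs $(i,j)$, with $i$ a nonempty subset of $\{1,\dots,N_{\rm TX}\}$ and $j$ a nonempty subset of $\{1,\dots,N_{\rm RX}\}$. For each $(i,j)\in V$ there is a message $W_{i\to j}$; the messages are independent, and $W_{i\to j}$ is uniform on $\{1,\dots,2^{NR_{i\to j}}\}$ (rounded to an integer), where $N$ is the block-length. It is known to all transmitters in $i$ and must be decoded by all receivers in $j$. Achievability. A rate vector $(R_{i\to j})_{(i,j)\in V}$ is achievable if there is a sequence (in $N$) of encoding functions $X_k^N=X_k^N(\{W_{i\to j}: (i,j)\in V,\ k\in i\})$ and decoding functions $\widehat W^z_{i\to j}=\widehat W^z_{i\to j}(Y_z^N)$, for $(i,j)\in V$ and $z\in j$, such that $\max_{z,i,j}\Pr[\widehat W^z_{i\to j}\ne W_{i\to j}]\to 0$ as $N\to\infty$. The capacity region is the convex closure of the set of achievable rate vectors. Superposition coding graph. It is a directed graph $(V,S)$ with node set $V$ and edge set $S\subseteq V\times V$. The random variable $U_{i\to j}$ is attached to node $(i,j)$, and an edge from $(l,m)$ to $(i,j)$ means that the codeword of $(i,j)$ (top) is superimposed on that of $(l,m)$ (bottom). The graph is required to satisfy: (1) if there is an edge from $(l,m)$ to $(i,j)$, with $(l,m)\neq(i,j)$, then $i\subseteq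 l$ (the bottom message is encoded by a larger set of encoders) and $j\subseteq m$ (the bottom message is decoded by a larger set of decoders); (2) transitivity: edges $(v,t)\to(l,m)$ and $(l,m)\to(i,j)$ imply an edge $(v,t)\to(i,j)$. Such a graph is a directed acyclic graph. $\mathrm{pa}_S(U_{i\to j})$ denotes the set of parents of node $(i,j)$ in $(V,S)$ (or the corresponding random variables), and for a set $F$ of nodes, $\mathrm{pa}_S(F)$ is the union of the parent sets of its nodes. *)

theory Defs
  imports "HOL-Probability.Probability"
begin

section \<open>One-hop networks\<close>

text \<open>
  Transmitters and receivers are the elements of the finite types \<open>'tx\<close> and \<open>'rx\<close>, so that
  \<^term>\<open>CARD('tx::finite)\<close> and \<^term>\<open>CARD('rx::finite)\<close> are the arbitrary numbers of transmitters
  and receivers. The pair \<open>(i, j)\<close> stands for the message from the transmitters in \<open>i\<close> to the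
  receivers in \<open>j\<close>.
\<close>

type_synonym ('tx, 'rx) node = "'tx set \<times> 'rx set"

definition message_allocation :: "('tx, 'rx) node set \<Rightarrow> bool" where
  "message_allocation V \<longleftrightarrow> (\<forall>(i, j) \<in> V. i \<noteq> {} \<and> j \<noteq> {})"

definition known_at :: "('tx, 'rx) node set \<Rightarrow> 'tx \<Rightarrow> ('tx, 'rx) node set" where
  "known_at V k = {(i, j) \<in> V. k \<in> i}"

definition decoded_at :: "('tx, 'rx) node set \<Rightarrow> 'rx \<Rightarrow> ('tx, 'rx) node set" where
  "decoded_at V z = {(i, j) \<in> V. z \<in> j}"

text \<open>
  \<open>A k\<close> and \<open>B z\<close> are the alphabets of the \<open>k\<close>-th input and of the \<open>z\<close>-th output. The values of \<open>P\<close>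
  at input tuples that leave the alphabets are irrelevant.
\<close>

definition discrete_channel ::
  "('tx \<Rightarrow> 'x set) \<Rightarrow> ('rx \<Rightarrow> 'y set) \<Rightarrow> (('tx \<Rightarrow> 'x) \<Rightarrow> ('rx \<Rightarrow> 'y) pmf) \<Rightarrow> bool" where
  "discrete_channel A B P \<longleftrightarrow>
     (\<forall>k. finite (A k) \<and> A k \<noteq> {}) \<and> (\<forall>z. finite (B z) \<and> B z \<noteq> {}) \<and>
     (\<forall>x. (\<forall>k. x k \<in> A k) \<longrightarrow> (\<forall>y \<in> set_pmf (P x). \<forall>z. y z \<in> B z))"


section \<open>Codes, achievable rates and capacity region\<close>

text \<open>\<open>2\<^sup>n\<^sup>R\<close> is rounded up.\<close>

definition num_messages :: "nat \<Rightarrow> real \<Rightarrow> nat" where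
  "num_messages n r = nat \<lceil>2 powr (real n * r)\<rceil>"

text \<open>
  An encoder maps the tuple of messages known at its transmitter to a sequence of channel inputs; a
  decoder maps a sequence of channel outputs to a message estimate. Only the times \<open>t < n\<close> matter:
  sequences are made undefined elsewhere, and so are message tuples outside of their index set.
\<close>

type_synonym ('tx, 'rx, 'x) encoders =
  "'tx \<Rightarrow> (('tx, 'rx) node \<Rightarrow> nat) \<Rightarrow> nat \<Rightarrow> 'x"

type_synonym ('tx, 'rx, 'y) decoders =
  "'rx \<Rightarrow> ('tx, 'rx) node \<Rightarrow> (nat \<Rightarrow> 'y) \<Rightarrow> nat"

definition valid_encoders ::
  "('tx \<Rightarrow> 'x set) \<Rightarrow> nat \<Rightarrow> ('tx, 'rx, 'x) encoders \<Rightarrow> bool" where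
  "valid_encoders A n enc \<longleftrightarrow> (\<forall>k w. \<forall>t<n. enc k w t \<in> A k)"

definition messages_pmf ::
  "('tx::finite, 'rx::finite) node set \<Rightarrow> real ^ ('tx, 'rx) node \<Rightarrow> nat \<Rightarrow>
   (('tx, 'rx) node \<Rightarrow> nat) pmf" where
  "messages_pmf V R n = Pi_pmf V undefined (\<lambda>v. pmf_of_set {1..num_messages n (R $ v)})"

definition transmit ::
  "('tx, 'rx) node set \<Rightarrow> (('tx \<Rightarrow> 'x) \<Rightarrow> ('rx \<Rightarrow> 'y) pmf) \<Rightarrow> nat \<Rightarrow> ('tx, 'rx, 'x) encoders \<Rightarrow>
   (('tx, 'rx) node \<Rightarrow> nat) \<Rightarrow> (nat \<Rightarrow> 'rx \<Rightarrow> 'y) pmf" where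
  "transmit V P n enc w =
     Pi_pmf {..<n} undefined (\<lambda>t. P (\<lambda>k. enc k (restrict w (known_at V k)) t))"

definition transmission_pmf ::
  "('tx::finite, 'rx::finite) node set \<Rightarrow> (('tx \<Rightarrow> 'x) \<Rightarrow> ('rx \<Rightarrow> 'y) pmf) \<Rightarrow>
   real ^ ('tx, 'rx) node \<Rightarrow> nat \<Rightarrow> ('tx, 'rx, 'x) encoders \<Rightarrow>
   ((('tx, 'rx) node \<Rightarrow> nat) \<times> (nat \<Rightarrow> 'rx \<Rightarrow> 'y)) pmf" where
  "transmission_pmf V P R n enc =
     bind_pmf (messages_pmf V R n) (\<lambda>w. map_pmf (Pair w) (transmit V P n enc w))"

definition error_prob ::
  "('tx::finite, 'rx::finite) node set \<Rightarrow> (('tx \<Rightarrow> 'x) \<Rightarrow> ('rx \<Rightarrow> 'y) pmf) \<Rightarrow>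
   real ^ ('tx, 'rx) node \<Rightarrow> nat \<Rightarrow> ('tx, 'rx, 'x) encoders \<Rightarrow> ('tx, 'rx, 'y) decoders \<Rightarrow>
   'rx \<Rightarrow> ('tx, 'rx) node \<Rightarrow> real" where
  "error_prob V P R n enc dec z v =
     measure_pmf.prob (transmission_pmf V P R n enc)
       {(w, y). dec z v (\<lambda>t\<in>{..<n}. y t z) \<noteq> w v}"

text \<open>Inserting \<open>0\<close> matters only for an empty message allocation.\<close>

definition max_error_prob ::
  "('tx::finite, 'rx::finite) node set \<Rightarrow> (('tx \<Rightarrow> 'x) \<Rightarrow> ('rx \<Rightarrow> 'y) pmf) \<Rightarrow>
   real ^ ('tx, 'rx) node \<Rightarrow> nat \<Rightarrow> ('tx, 'rx, 'x) encoders \<Rightarrow> ('tx, 'rx, 'y) decoders \<Rightarrow> real" where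
  "max_error_prob V P R n enc dec =
     Max (insert 0 {error_prob V P R n enc dec z v | z v. v \<in> decoded_at V z})"

text \<open>
  A rate vector indexed by \<open>V\<close> is represented by a vector indexed by all pairs of sets that vanishes
  outside \<open>V\<close>.
\<close>

definition rate_vectors :: "('tx::finite, 'rx::finite) node set \<Rightarrow> (real ^ ('tx, 'rx) node) set" where
  "rate_vectors V = {R. (\<forall>v\<in>V. 0 \<le> R $ v) \<and> (\<forall>v. v \<notin> V \<longrightarrow> R $ v = 0)}"

definition achievable ::
  "('tx::finite, 'rx::finite) node set \<Rightarrow> ('tx \<Rightarrow> 'x set) \<Rightarrow>
   (('tx \<Rightarrow> 'x) \<Rightarrow> ('rx \<Rightarrow> 'y) pmf) \<Rightarrow> real ^ ('tx, 'rx) node \<Rightarrow> bool" where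
  "achievable V A P R \<longleftrightarrow>
     R \<in> rate_vectors V \<and>
     (\<exists>(enc :: nat \<Rightarrow> ('tx, 'rx, 'x) encoders) (dec :: nat \<Rightarrow> ('tx, 'rx, 'y) decoders).
        (\<forall>n. valid_encoders A n (enc n)) \<and>
        (\<lambda>n. max_error_prob V P R n (enc n) (dec n)) \<longlonglongrightarrow> 0)"

definition capacity_region ::
  "('tx::finite, 'rx::finite) node set \<Rightarrow> ('tx \<Rightarrow> 'x set) \<Rightarrow>
   (('tx \<Rightarrow> 'x) \<Rightarrow> ('rx \<Rightarrow> 'y) pmf) \<Rightarrow> (real ^ ('tx, 'rx) node) set" where
  "capacity_region V A P = closure (convex hull {R. achievable V A P R})"


section \<open>Superposition coding\<close>

text \<open>An edge goes from the bottom codeword to the one superimposed on it.\<close>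

definition superposition_graph ::
  "('tx, 'rx) node set \<Rightarrow> (('tx, 'rx) node \<times> ('tx, 'rx) node) set \<Rightarrow> bool" where
  "superposition_graph V S \<longleftrightarrow>
     S \<subseteq> V \<times> V \<and>
     (\<forall>l m i j. ((l, m), (i, j)) \<in> S \<and> (l, m) \<noteq> (i, j) \<longrightarrow> i \<subseteq> l \<and> j \<subseteq> m) \<and>
     trans S \<and> acyclic S"

definition pa :: "('v \<times> 'v) set \<Rightarrow> 'v set \<Rightarrow> 'v set" where
  "pa S F = (\<Union>v\<in>F. {a. (a, v) \<in> S})"

text \<open>
  The conditional probability given a null event is \<open>0\<close> here. This is harmless: if the event
  conditioned on is null for some \<open>v\<close>, then the left-hand side vanishes as well.
\<close>

definition superposition_factorization ::
  "'w measure \<Rightarrow> ('tx, 'rx) node set \<Rightarrow> (('tx, 'rx) node \<times> ('tx, 'rx) node) set \<Rightarrow>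
   ('w \<Rightarrow> 'q) \<Rightarrow> (('tx, 'rx) node \<Rightarrow> 'w \<Rightarrow> 'u) \<Rightarrow> bool" where
  "superposition_factorization M V S Q U \<longleftrightarrow>
     (\<forall>q u. \<P>(\<omega> in M. Q \<omega> = q \<and> (\<forall>v\<in>V. U v \<omega> = u v)) =
        \<P>(\<omega> in M. Q \<omega> = q) *
        (\<Prod>v\<in>V. \<P>(\<omega> in M. U v \<omega> = u v \<bar> (\<forall>a\<in>pa S {v}. U a \<omega> = u a) \<and> Q \<omega> = q)))"

text \<open>
  \<open>Y\<close> is the output of the channel \<open>P\<close> at input \<open>X\<close>, with \<open>(Q, U) \<rightarrow> X \<rightarrow> Y\<close> a Markov chain.
\<close>

definition channel_output ::
  "'w measure \<Rightarrow> 'v set \<Rightarrow> (('tx \<Rightarrow> 'x) \<Rightarrow> ('rx \<Rightarrow> 'y) pmf) \<Rightarrow>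
   ('w \<Rightarrow> 'q) \<Rightarrow> ('v \<Rightarrow> 'w \<Rightarrow> 'u) \<Rightarrow> ('tx \<Rightarrow> 'w \<Rightarrow> 'x) \<Rightarrow> ('rx \<Rightarrow> 'w \<Rightarrow> 'y) \<Rightarrow> bool" where
  "channel_output M V P Q U X Y \<longleftrightarrow>
     (\<forall>q u x y.
        \<P>(\<omega> in M. Q \<omega> = q \<and> (\<forall>v\<in>V. U v \<omega> = u v) \<and> (\<forall>k. X k \<omega> = x k) \<and> (\<forall>z. Y z \<omega> = y z)) =
        \<P>(\<omega> in M. Q \<omega> = q \<and> (\<forall>v\<in>V. U v \<omega> = u v) \<and> (\<forall>k. X k \<omega> = x k)) * pmf (P x) y)"

text \<open>
  The library's conditional mutual information, in bits, of random variables with finitely many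
  values. The abbreviation that the library has for this is local to \<^locale>\<open>information_space\<close>.
\<close>

abbreviation cond_mutual_info ::
  "'w measure \<Rightarrow> ('w \<Rightarrow> 'a) \<Rightarrow> ('w \<Rightarrow> 'b) \<Rightarrow> ('w \<Rightarrow> 'c) \<Rightarrow> real" where
  "cond_mutual_info M X Y Z \<equiv>
     prob_space.conditional_mutual_information M 2
       (count_space (X ` space M)) (count_space (Y ` space M)) (count_space (Z ` space M)) X Y Z"

definition superposition_region ::
  "'w measure \<Rightarrow> ('tx::finite, 'rx::finite) node set \<Rightarrow>
   (('tx, 'rx) node \<times> ('tx, 'rx) node) set \<Rightarrow>
   ('w \<Rightarrow> 'q) \<Rightarrow> (('tx, 'rx) node \<Rightarrow> 'w \<Rightarrow> 'u) \<Rightarrow> ('rx \<Rightarrow> 'w \<Rightarrow> 'y) \<Rightarrow>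
   (real ^ ('tx, 'rx) node) set" where
  "superposition_region M V S Q U Y =
     {R \<in> rate_vectors V.
        \<forall>z. \<forall>F \<subseteq> decoded_at V z. pa S F \<subseteq> F \<longrightarrow>
          (\<Sum>v \<in> decoded_at V z - F. R $ v)
            \<le> cond_mutual_info M (Y z)
                (\<lambda>\<omega>. \<lambda>v \<in> decoded_at V z - F. U v \<omega>)
                (\<lambda>\<omega>. (\<lambda>v \<in> F. U v \<omega>, Q \<omega>))}"

end

(* Random coding with threshold decoding. At every time instant the codeword of a node is drawn from the
   conditional law given the time-sharing variable and the codewords of its parents, independently for every
   tuple of messages of the node and its parents. For a parent-closed F below V^z, let
     rho_F = p(y, u_{V^z}, q) p(u_F, q) / (p(u_{V^z}, q) p(y, u_F, q)),
   whose expected logarithm is the bound I(Y_z; U_{V^z - F} | U_F, Q). Receiver z accepts a message tuple if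
   for all F the product of rho_F over the block is at least 2^(n gamma_F), where gamma_F lies strictly
   between the sum of the rates outside F and the mutual information.
   The transmitted tuple is rejected with exponentially small probability, because
   E [(rho_F 2^(-gamma_F))^(-s)] < 1 for some small s > 0 (derivative at s = 0). If a wrong tuple leaves
   exactly the codewords of F unchanged, then a change of measure gives E rho_F <= 1, so Markov's inequality
   bounds the probability of its acceptance by 2^(-n gamma_F), which beats the number of such tuples.
   Rates on the boundary of the region are limits of the scaled rates c R, c < 1, for which every bound with
   a positive left-hand side is strict. *)
theory Submission
  imports Defs
begin

section \<open>Products and mixtures of probability mass functions\<close>

text \<open>Only the index \<open>\<pi>\<close> can produce the outcome \<open>b\<close>, so the sum
  over the mixing variable collapses to one term.\<close>

lemma pmf_bind_determined:
  assumes "\<And>a. a \<in> set_pmf A \<Longrightarrow> b \<in> set_pmf (B a) \<Longrightarrow> a = \<pi>"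
  shows "pmf (bind_pmf A B) b = pmf A \<pi> * pmf (B \<pi>) b"
proof -
  have "pmf (bind_pmf A B) b = (\<integral>a. pmf (B a) b \<partial>A)"
    by (rule pmf_bind)
  also have "\<dots> = (\<Sum>a\<in>{\<pi>}. pmf A a *\<^sub>R pmf (B a) b)"
    using assms by (intro integral_measure_pmf) (auto simp: set_pmf_iff)
  finally show ?thesis by simp
qed

lemma pmf_map_inj_Pair: "pmf (map_pmf (Pair a) p) (a, b) = pmf p b"
  by (rule pmf_map_inj') (auto simp: inj_on_def)

text \<open>The source of independence in the random codebook: different message tuples select
  different, independent entries of a node.\<close>

lemma Pi_pmf_two_components:
  assumes "finite A" "a \<in> A" "b \<in> A" "a \<noteq> b"
  shows "map_pmf (\<lambda>g. (g a, g b)) (Pi_pmf A d p) = bind_pmf (p a) (\<lambda>x. map_pmf (Pair x) (p b))"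
proof -
  let ?A = "A - {a}"
  have A: "A = insert a ?A" using assms by auto
  have "map_pmf (\<lambda>g. (g a, g b)) (Pi_pmf (insert a ?A) d p) =
      map_pmf (\<lambda>(x, g). (x, g b)) (pair_pmf (p a) (Pi_pmf ?A d p))"
    using assms by (subst Pi_pmf_insert) (auto simp: pmf.map_comp o_def case_prod_unfold intro!: map_pmf_cong)
  also have "\<dots> = bind_pmf (p a) (\<lambda>x. map_pmf (Pair x) (map_pmf (\<lambda>g. g b) (Pi_pmf ?A d p)))"
    by (simp add: pair_pmf_def map_bind_pmf map_pmf_def bind_assoc_pmf bind_return_pmf)
  also have "map_pmf (\<lambda>g. g b) (Pi_pmf ?A d p) = p b"
    using assms by (subst Pi_pmf_component) auto
  finally show ?thesis using A by simp
qed

section \<open>Superposition codebooks\<close>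

fun topological :: "('v \<times> 'v) set \<Rightarrow> 'v list \<Rightarrow> bool" where
  "topological S [] \<longleftrightarrow> True"
| "topological S (v # vs) \<longleftrightarrow> v \<notin> set vs \<and> pa S {v} \<inter> set (v # vs) = {} \<and> topological S vs"

text \<open>No parent of a node stands at or after it, but parents may be missing from the list
  altogether; this form survives filtering.\<close>

lemma topological_filter: "topological S vs \<Longrightarrow> topological S (filter P vs)"
  by (induction vs) auto

lemma ex_topological:
  assumes "acyclic S" "finite S" "finite V"
  shows "\<exists>vs. set vs = V \<and> topological S vs"
  using assms(3)
proof (induction V rule: finite_psubset_induct)
  case (psubset V)
  show ?case
  proof (cases "V = {}")
    case False
    have "wf S" using assms finite_acyclic_wf by blast
    then obtain v where v: "v \<in> V" "\<And>a. (a, v) \<in> S \<Longrightarrow> a \<notin> V"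
      using False wfE_min[of S _ V] by blast
    obtain vs where "set vs = V - {v}" "topological S vs"
      using psubset.IH[of "V - {v}"] v(1) by auto
    then have "set (v # vs) = V \<and> topological S (v # vs)"
      using v by (auto simp: pa_def)
    then show ?thesis by blast
  qed auto
qed

text \<open>\<open>\<kappa> v q u\<close> stands for the conditional law of the symbol at
  \<open>v\<close> given the time-sharing value \<open>q\<close> and the symbols of the parents of
  \<open>v\<close>. It takes a whole tuple \<open>u\<close>, of which \<open>\<kappa>_cong\<close>
  lets only the parent coordinates matter.\<close>

locale superposition =
  fixes S :: "('v \<times> 'v) set" and V :: "'v set"
    and \<kappa> :: "'v \<Rightarrow> 'q \<Rightarrow> ('v \<Rightarrow> 'u) \<Rightarrow> 'u pmf"
  assumes finite_V: "finite V"
    and trans_S: "trans S" and acyclic_S: "acyclic S" and S_subset: "S \<subseteq> V \<times> V"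
    and \<kappa>_cong: "\<And>v q u u'. (\<And>a. a \<in> pa S {v} \<Longrightarrow> u a = u' a) \<Longrightarrow> \<kappa> v q u = \<kappa> v q u'"
begin

section \<open>Drawing the symbols of the nodes one after another\<close>

primrec draw :: "'v list \<Rightarrow> 'q \<Rightarrow> ('v \<Rightarrow> 'u) \<Rightarrow> ('v \<Rightarrow> 'u) pmf" where
  "draw [] q u = return_pmf u"
| "draw (v # vs) q u = bind_pmf (\<kappa> v q u) (\<lambda>x. draw vs q (u(v := x)))"

lemma draw_unchanged: "b \<in> set_pmf (draw vs q u) \<Longrightarrow> v \<notin> set vs \<Longrightarrow> b v = u v"
  by (induction vs arbitrary: u) fastforce+

text \<open>Each coordinate is written once and parents are final before they are read, so every
  kernel can be evaluated at the final tuple \<open>b\<close>.\<close>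

lemma pmf_draw:
  assumes "topological S vs" "\<And>v. v \<notin> set vs \<Longrightarrow> b v = u v"
  shows "pmf (draw vs q u) b = (\<Prod>v\<in>set vs. pmf (\<kappa> v q b) (b v))"
  using assms
proof (induction vs arbitrary: u)
  case Nil
  then have "b = u" by auto
  then show ?case by simp
next
  case (Cons v vs)
  have "pmf (draw (v # vs) q u) b = pmf (\<kappa> v q u) (b v) * pmf (draw vs q (u(v := b v))) b"
    using Cons.prems draw_unchanged[of b vs q _ v] by (simp, subst pmf_bind_determined) auto
  also have "\<kappa> v q u = \<kappa> v q b"
  proof (rule \<kappa>_cong)
    fix a assume "a \<in> pa S {v}"
    then have "a \<notin> set (v # vs)" using Cons.prems(1) by (auto simp del: set_simps)
    then show "u a = b a" using Cons.prems(2) by simp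
  qed
  also have "pmf (draw vs q (u(v := b v))) b = (\<Prod>v\<in>set vs. pmf (\<kappa> v q b) (b v))"
    using Cons.prems by (intro Cons.IH) auto
  finally show ?case using Cons.prems by simp
qed

lemma draw_restrict:
  assumes "pa S H \<subseteq> H"
  shows "map_pmf (\<lambda>u. restrict u H) (draw vs q u) = draw (filter (\<lambda>v. v \<in> H) vs) q (restrict u H)"
proof (induction vs arbitrary: u)
  case (Cons v vs)
  have "\<kappa> v q (restrict u H) = \<kappa> v q u" if "v \<in> H"
    using that assms by (intro \<kappa>_cong) (auto simp: pa_def)
  moreover have "restrict (u(v := x)) H = (if v \<in> H then (restrict u H)(v := x) else restrict u H)" for x
    by (auto simp: restrict_def)
  ultimately show ?case
    unfolding draw.simps map_bind_pmf Cons.IH by (simp del: restrict_apply)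
qed auto

section \<open>Random codebooks and the joint law of two codeword tuples\<close>

definition anc :: "'v \<Rightarrow> 'v set" where
  "anc v = insert v (pa S {v})"

text \<open>A codebook \<open>g\<close> for one time instant holds at node \<open>v\<close> one
  symbol per tuple of messages on \<open>anc v\<close>: the index of a superimposed codeword
  comprises the messages of all codewords below it.\<close>

definition codewords :: "('v \<Rightarrow> ('v \<Rightarrow> 'm) \<Rightarrow> 'u) \<Rightarrow> ('v \<Rightarrow> 'm) \<Rightarrow> 'v \<Rightarrow> 'u" where
  "codewords g w = (\<lambda>v\<in>V. g v (restrict w (anc v)))"

text \<open>Since \<open>S\<close> is transitive, the parents of a node are already all its
  ancestors.\<close>

lemma anc_trans: "a \<in> anc v \<Longrightarrow> anc a \<subseteq> anc v"
  using trans_S by (auto simp: anc_def pa_def dest: transD)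

lemma anc_closed: "pa S H \<subseteq> H \<Longrightarrow> v \<in> H \<Longrightarrow> anc v \<subseteq> H"
  by (auto simp: anc_def pa_def)

lemma anc_V: "v \<in> V \<Longrightarrow> anc v \<subseteq> V"
  using S_subset by (auto simp: anc_def pa_def)

text \<open>Hence the messages of a parent-closed set of nodes suffice to compute the codewords of
  that set.\<close>

lemma codewords_restrict:
  assumes "pa S H \<subseteq> H" "v \<in> H"
  shows "codewords g (restrict w H) v = codewords g w v"
  using anc_closed[OF assms] by (auto simp: codewords_def Int_absorb1 restrict_restrict)

text \<open>The entry for \<open>m\<close> is drawn on top of the parent codewords that
  \<open>m\<close> selects. Away from the parents the values of \<open>codewords g m\<close> are
  meaningless, but \<open>\<kappa>\<close> ignores them.\<close>

primrec draw_codebook :: "('v \<Rightarrow> 'm set) \<Rightarrow> 'v list \<Rightarrow> 'q \<Rightarrow>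
    ('v \<Rightarrow> ('v \<Rightarrow> 'm) \<Rightarrow> 'u) \<Rightarrow> ('v \<Rightarrow> ('v \<Rightarrow> 'm) \<Rightarrow> 'u) pmf" where
  "draw_codebook W [] q g = return_pmf g"
| "draw_codebook W (v # vs) q g =
     bind_pmf (Pi_pmf (PiE (anc v) W) undefined (\<lambda>m. \<kappa> v q (codewords g m)))
       (\<lambda>h. draw_codebook W vs q (g(v := h)))"

text \<open>The nodes at which both tuples select the same codebook entry: a correct message on top
  of a wrong one already selects another entry.\<close>

definition agree :: "'v set \<Rightarrow> ('v \<Rightarrow> 'm) \<Rightarrow> ('v \<Rightarrow> 'm) \<Rightarrow> 'v set" where
  "agree H w w' = {v \<in> H. \<forall>a\<in>anc v. w a = w' a}"

lemma agree_closed: "pa S H \<subseteq> H \<Longrightarrow> pa S (agree H w w') \<subseteq> agree H w w'"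
proof
  fix a assume H: "pa S H \<subseteq> H" and "a \<in> pa S (agree H w w')"
  then obtain v where v: "v \<in> H" "\<forall>a\<in>anc v. w a = w' a" "(a, v) \<in> S"
    by (auto simp: agree_def pa_def)
  moreover have "a \<in> H" using H v by (auto simp: pa_def)
  moreover have "anc a \<subseteq> anc v" using v by (intro anc_trans) (auto simp: anc_def pa_def)
  ultimately show "a \<in> agree H w w'" by (auto simp: agree_def)
qed

text \<open>
  Given all codewords \<open>a\<close> of the transmitted tuple, the codewords of a competing tuple coincide with \<open>a\<close>
  on the agreement set, and the others are drawn afresh on top of them.
\<close>

lemma codebook_pair:
  fixes W :: "'v \<Rightarrow> 'm set"
  assumes W: "\<And>v. v \<in> V \<Longrightarrow> finite (W v)"
    and H: "H \<subseteq> V" "pa S H \<subseteq> H"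
    and w: "w \<in> PiE V W" and w': "w' \<in> PiE H W"
    and vs: "topological S vs" "set vs \<subseteq> V"
  defines "F \<equiv> agree H w w'"
  shows "map_pmf (\<lambda>g. (codewords g w, restrict (codewords g w') H)) (draw_codebook W vs q g) =
     bind_pmf (draw vs q (codewords g w)) (\<lambda>a.
       map_pmf (Pair a) (draw (filter (\<lambda>v. v \<in> H - F) vs) q
         (\<lambda>v. if v \<in> F \<inter> set vs then a v else restrict (codewords g w') H v)))"
  using vs
\<comment> \<open>The induction runs over a partly filled codebook \<open>g\<close>. Nodes of
  \<open>F\<close> still to be drawn copy the symbol of \<open>a\<close>; those already drawn carry
  equal symbols in both tuples, since \<open>w\<close> and \<open>w'\<close> select the same entry
  there.\<close>
proof (induction vs arbitrary: g)
  case Nil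
  then show ?case by (simp add: bind_return_pmf)
next
  case (Cons v vs)
  define a0 where "a0 = codewords g w"
  define b0 where "b0 = restrict (codewords g w') H"
  define m where "m = restrict w (anc v)"
  define m' where "m' = restrict w' (anc v)"
  define K where "K = Pi_pmf (PiE (anc v) W) undefined (\<lambda>m. \<kappa> v q (codewords g m))"
  \<comment> \<open>The right-hand side for the remaining nodes, as a function of the two tuples of
    symbols drawn so far.\<close>
  define \<Psi> where "\<Psi> = (\<lambda>a0 b0. bind_pmf (draw vs q a0) (\<lambda>a.
       map_pmf (Pair a) (draw (filter (\<lambda>v. v \<in> H - F) vs) q
         (\<lambda>v. if v \<in> F \<inter> set vs then a v else b0 v))))"
  have v: "v \<in> V" "v \<notin> set vs" and pav: "pa S {v} \<inter> set (v # vs) = {}" and top: "topological S vs"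
    using Cons.prems by auto
  have ancv: "anc v \<subseteq> V" "v \<in> anc v" using anc_V v by (auto simp: anc_def)
  have fin: "finite (PiE (anc v) W)"
    using ancv finite_V W by (intro finite_PiE) (auto intro: finite_subset)
  have m_in: "m \<in> PiE (anc v) W" using w ancv by (auto simp: m_def)
  have a_upd: "codewords (g(v := h)) w = a0(v := h m)" for h
    using v by (auto simp: codewords_def a0_def m_def)
  have b_upd: "restrict (codewords (g(v := h)) w') H = (if v \<in> H then b0(v := h m') else b0)" for h
    using v H by (auto simp: codewords_def b0_def m'_def)
  have cw: "codewords g (restrict x (anc v)) a = codewords g x a" if "a \<in> pa S {v}" for x :: "'v \<Rightarrow> 'm" and a
    using anc_trans[of a v] that by (auto simp: codewords_def anc_def Int_absorb1 restrict_restrict)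
  have \<kappa>m: "\<kappa> v q (codewords g m) = \<kappa> v q a0"
    unfolding m_def a0_def by (intro \<kappa>_cong cw)
  have comp_m: "map_pmf (\<lambda>h. h m) K = \<kappa> v q a0"
    unfolding K_def using m_in fin by (subst Pi_pmf_component) (auto simp: \<kappa>m)
  have LHS: "map_pmf (\<lambda>g. (codewords g w, restrict (codewords g w') H)) (draw_codebook W (v # vs) q g) =
      bind_pmf K (\<lambda>h. \<Psi> (a0(v := h m)) (if v \<in> H then b0(v := h m') else b0))"
  proof -
    have IH: "map_pmf (\<lambda>g. (codewords g w, restrict (codewords g w') H)) (draw_codebook W vs q g') =
        \<Psi> (codewords g' w) (restrict (codewords g' w') H)" for g'
      unfolding \<Psi>_def using Cons.prems by (intro Cons.IH top) auto
    show ?thesis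
      unfolding draw_codebook.simps map_bind_pmf K_def[symmetric] IH a_upd b_upd ..
  qed
  have bindm: "bind_pmf K (\<lambda>h. X (h m)) = bind_pmf (\<kappa> v q a0) X" for X :: "'u \<Rightarrow> 'c pmf"
    unfolding comp_m[symmetric] by (simp add: bind_map_pmf)
  have draw_v: "b v = x" if "b \<in> set_pmf (draw vs q (a0(v := x)))" for b x
    using draw_unchanged[OF that v(2)] by simp
  show ?case
  proof (cases "v \<in> H")
    case False
    then have F: "v \<notin> F" by (simp add: F_def agree_def)
    have "bind_pmf K (\<lambda>h. \<Psi> (a0(v := h m)) b0) = bind_pmf (\<kappa> v q a0) (\<lambda>x. \<Psi> (a0(v := x)) b0)"
      by (rule bindm)
    moreover have "F \<inter> set (v # vs) = F \<inter> set vs" using F by auto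
    ultimately show ?thesis
      unfolding LHS a0_def[symmetric] b0_def[symmetric] draw.simps bind_assoc_pmf
      using False by (simp add: \<Psi>_def del: restrict_apply)
  next
    case vH: True
    have m'_in: "m' \<in> PiE (anc v) W" using w' anc_closed[OF H(2) vH] by (auto simp: m'_def)
    have \<kappa>m': "\<kappa> v q (codewords g m') = \<kappa> v q b0"
      unfolding m'_def b0_def using anc_closed[OF H(2) vH]
      by (intro \<kappa>_cong) (use cw in \<open>auto simp: anc_def\<close>)
    show ?thesis
    proof (cases "v \<in> F")
      case True
      \<comment> \<open>Both tuples read the same entry of \<open>v\<close>, so one symbol
        \<open>x\<close> enters both; by \<open>draw_v\<close> it can equally be read off
        \<open>a\<close> afterwards.\<close>
      have mm: "m' = m" using True by (auto simp: m_def m'_def F_def agree_def restrict_def)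
      have upd: "(\<lambda>y. if y \<in> F \<inter> set vs then a y else (b0(v := x)) y) =
          (\<lambda>y. if y \<in> F \<inter> set (v # vs) then a y else b0 y)"
        if "a \<in> set_pmf (draw vs q (a0(v := x)))" for a x
        using True v draw_v[OF that] by auto
      have "bind_pmf K (\<lambda>h. \<Psi> (a0(v := h m)) (b0(v := h m))) =
          bind_pmf (\<kappa> v q a0) (\<lambda>x. \<Psi> (a0(v := x)) (b0(v := x)))"
        by (rule bindm)
      also have "\<dots> = bind_pmf (\<kappa> v q a0) (\<lambda>x. bind_pmf (draw vs q (a0(v := x))) (\<lambda>a.
          map_pmf (Pair a) (draw (filter (\<lambda>v. v \<in> H - F) vs) q
            (\<lambda>y. if y \<in> F \<inter> set (v # vs) then a y else b0 y))))"
        unfolding \<Psi>_def by (intro bind_pmf_cong refl) (simp only: upd)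
      finally show ?thesis
        unfolding LHS a0_def[symmetric] b0_def[symmetric] draw.simps bind_assoc_pmf
        using vH True mm by (simp del: restrict_apply)
    next
      case False
      \<comment> \<open>The tuples read different entries, whose symbols are independent; that of
        the competing tuple may then be drawn after all of \<open>a\<close>.\<close>
      have mm: "m \<noteq> m'"
        using False vH by (auto simp: m_def m'_def F_def agree_def restrict_def fun_eq_iff)
      have "bind_pmf K (\<lambda>h. \<Psi> (a0(v := h m)) (b0(v := h m'))) =
          bind_pmf (map_pmf (\<lambda>h. (h m, h m')) K) (\<lambda>(x, y). \<Psi> (a0(v := x)) (b0(v := y)))"
        by (simp add: bind_map_pmf)
      also have "map_pmf (\<lambda>h. (h m, h m')) K = bind_pmf (\<kappa> v q a0) (\<lambda>x. map_pmf (Pair x) (\<kappa> v q b0))"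
        unfolding K_def using fin m_in m'_in mm by (subst Pi_pmf_two_components) (auto simp: \<kappa>m \<kappa>m')
      also have "bind_pmf \<dots> (\<lambda>(x, y). \<Psi> (a0(v := x)) (b0(v := y))) =
          bind_pmf (\<kappa> v q a0) (\<lambda>x. bind_pmf (draw vs q (a0(v := x))) (\<lambda>a. bind_pmf (\<kappa> v q b0) (\<lambda>y.
             map_pmf (Pair a) (draw (filter (\<lambda>v. v \<in> H - F) vs) q
         (\<lambda>a'. if a' \<in> F \<inter> set vs then a a' else (b0(v := y)) a')))))"
        by (simp add: bind_assoc_pmf bind_map_pmf \<Psi>_def) (subst bind_commute_pmf, rule refl)
      also have "\<dots> = bind_pmf (\<kappa> v q a0) (\<lambda>x. bind_pmf (draw vs q (a0(v := x))) (\<lambda>a.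
          map_pmf (Pair a) (bind_pmf (\<kappa> v q (\<lambda>a'. if a' \<in> F \<inter> set vs then a a' else b0 a')) (\<lambda>y.
             (draw (filter (\<lambda>v. v \<in> H - F) vs) q
         ((\<lambda>a'. if a' \<in> F \<inter> set vs then a a' else b0 a')(v := y)))))))"
      proof -
        \<comment> \<open>No parent of \<open>v\<close> is among the remaining nodes, so the kernel
          does not notice which of them are copied from \<open>a\<close>.\<close>
        have 1: "\<kappa> v q b0 = \<kappa> v q (\<lambda>y. if y \<in> F \<inter> set vs then a y else b0 y)" for a
          using pav by (intro \<kappa>_cong) auto
        have 2: "(\<lambda>z. if z \<in> F \<inter> set vs then a z else (b0(v := y)) z) =
            (\<lambda>z. if z \<in> F \<inter> set vs then a z else b0 z)(v := y)" for a y
          using False by auto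
        show ?thesis
          unfolding map_bind_pmf 2 1[symmetric] ..
      qed
      finally have *: "bind_pmf K (\<lambda>h. \<Psi> (a0(v := h m)) (b0(v := h m'))) = \<dots>" .
      have 3: "F \<inter> set (v # vs) = F \<inter> set vs" using False by auto
      have 4: "filter (\<lambda>v. v \<in> H - F) (v # vs) = v # filter (\<lambda>v. v \<in> H - F) vs"
        using False vH by simp
      show ?thesis
        unfolding LHS if_P[OF vH] * a0_def[symmetric] b0_def[symmetric] 3 4 draw.simps bind_assoc_pmf ..
    qed
  qed
qed

end

section \<open>Joint law of codewords and channel output\<close>

text \<open>\<open>L\<close> is the law of the time-sharing variable, and \<open>ch\<close> combines
  the deterministic input maps with the channel.\<close>

locale superposition_channel = superposition S V \<kappa>
  for S :: "('v \<times> 'v) set" and V :: "'v set"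
    and \<kappa> :: "'v \<Rightarrow> 'q \<Rightarrow> ('v \<Rightarrow> 'u) \<Rightarrow> 'u pmf" +
  fixes L :: "'q pmf" and ch :: "'q \<Rightarrow> ('v \<Rightarrow> 'u) \<Rightarrow> 'y pmf"
begin

definition ord :: "'v list" where
  "ord = (SOME vs. set vs = V \<and> topological S vs)"

lemma set_ord: "set ord = V" and topological_ord: "topological S ord"
proof -
  have "finite S" using S_subset finite_V by (meson finite_SigmaI finite_subset)
  then have "\<exists>vs. set vs = V \<and> topological S vs"
    using ex_topological acyclic_S finite_V by blast
  from someI_ex[OF this] show "set ord = V" "topological S ord"
    by (auto simp: ord_def)
qed

definition joint :: "('q \<times> ('v \<Rightarrow> 'u) \<times> 'y) pmf" where
  "joint = bind_pmf L (\<lambda>q. bind_pmf (draw ord q (\<lambda>_. undefined)) (\<lambda>a. map_pmf (\<lambda>y. (q, a, y)) (ch q a)))"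

definition law :: "'v set \<Rightarrow> ('q \<times> ('v \<Rightarrow> 'u)) pmf" where
  "law H = map_pmf (\<lambda>(q, a, y). (q, restrict a H)) joint"

definition law_out :: "('y \<Rightarrow> 'o) \<Rightarrow> 'v set \<Rightarrow> ('q \<times> ('v \<Rightarrow> 'u) \<times> 'o) pmf" where
  "law_out \<rho> H = map_pmf (\<lambda>(q, a, y). (q, restrict a H, \<rho> y)) joint"

text \<open>This is p(y | u_H, q) / p(y | u_F, q) with \<open>b\<close> in the place of u_H;
  \<open>\<rho>\<close> projects all outputs onto that of one receiver.\<close>

definition info_ratio :: "('y \<Rightarrow> 'o) \<Rightarrow> 'v set \<Rightarrow> 'v set \<Rightarrow> 'q \<Rightarrow> ('v \<Rightarrow> 'u) \<Rightarrow> 'o \<Rightarrow> real" where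
  "info_ratio \<rho> H F q b y =
     pmf (law_out \<rho> H) (q, b, y) * pmf (law F) (q, restrict b F) /
     (pmf (law H) (q, b) * pmf (law_out \<rho> F) (q, restrict b F, y))"

definition codebook :: "('v \<Rightarrow> 'm set) \<Rightarrow> ('q \<times> ('v \<Rightarrow> ('v \<Rightarrow> 'm) \<Rightarrow> 'u)) pmf" where
  "codebook W = bind_pmf L (\<lambda>q. map_pmf (Pair q) (draw_codebook W ord q (\<lambda>_ _. undefined)))"

lemma info_ratio_nonneg: "0 \<le> info_ratio \<rho> H F q b y"
  by (simp add: info_ratio_def)

lemma law_alt:
  assumes "pa S H \<subseteq> H"
  shows "law H = bind_pmf L (\<lambda>q. map_pmf (Pair q) (draw (filter (\<lambda>v. v \<in> H) ord) q (\<lambda>_. undefined)))"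
proof -
  have "law H = bind_pmf L (\<lambda>q. map_pmf (Pair q) (map_pmf (\<lambda>a. restrict a H) (draw ord q (\<lambda>_. undefined))))"
    by (simp add: law_def joint_def map_bind_pmf pmf.map_comp o_def map_pmf_def bind_assoc_pmf
        bind_return_pmf)
  also have "\<dots> = bind_pmf L (\<lambda>q. map_pmf (Pair q) (draw (filter (\<lambda>v. v \<in> H) ord) q (\<lambda>_. undefined)))"
    unfolding draw_restrict[OF assms] by (simp add: restrict_def)
  finally show ?thesis .
qed

lemma pmf_law:
  assumes "pa S H \<subseteq> H" "H \<subseteq> V" "b \<in> extensional H"
  shows "pmf (law H) (q, b) = pmf L q * (\<Prod>v\<in>H. pmf (\<kappa> v q b) (b v))"
proof -
  have "pmf (law H) (q, b) = pmf L q * pmf (draw (filter (\<lambda>v. v \<in> H) ord) q (\<lambda>_. undefined)) b"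
    unfolding law_alt[OF assms(1)]
    by (subst pmf_bind_determined[where \<pi> = q]) (auto simp: pmf_map_inj_Pair)
  also have "pmf (draw (filter (\<lambda>v. v \<in> H) ord) q (\<lambda>_. undefined)) b =
      (\<Prod>v\<in>set (filter (\<lambda>v. v \<in> H) ord). pmf (\<kappa> v q b) (b v))"
    using assms topological_ord
    by (intro pmf_draw topological_filter) (auto simp: set_ord extensional_def)
  also have "set (filter (\<lambda>v. v \<in> H) ord) = H"
    using assms by (auto simp: set_ord)
  finally show ?thesis .
qed

text \<open>The chain rule p(u_H, q) = p(u_F, q) p(u_{H-F} | u_F, q): \<open>F\<close> is
  parent-closed, so its kernels do not see the symbols outside, and \<open>draw\<close> started from
  u_F realizes the conditional law.\<close>

lemma pmf_law_chain:
  assumes "pa S H \<subseteq> H" "H \<subseteq> V" "b \<in> extensional H" "pa S F \<subseteq> F" "F \<subseteq> H"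
  shows "pmf (law H) (q, b) =
    pmf (law F) (q, restrict b F) * pmf (draw (filter (\<lambda>v. v \<in> H - F) ord) q (restrict b F)) b"
proof -
  have "pmf (draw (filter (\<lambda>v. v \<in> H - F) ord) q (restrict b F)) b =
      (\<Prod>v\<in>set (filter (\<lambda>v. v \<in> H - F) ord). pmf (\<kappa> v q b) (b v))"
    using assms topological_ord
    by (intro pmf_draw topological_filter) (auto simp: set_ord extensional_def)
  also have "set (filter (\<lambda>v. v \<in> H - F) ord) = H - F"
    using assms by (auto simp: set_ord)
  finally have 1: "pmf (draw (filter (\<lambda>v. v \<in> H - F) ord) q (restrict b F)) b =
      (\<Prod>v\<in>H - F. pmf (\<kappa> v q b) (b v))" .
  have "pmf (law F) (q, restrict b F) = pmf L q * (\<Prod>v\<in>F. pmf (\<kappa> v q (restrict b F)) (restrict b F v))"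
    using assms by (intro pmf_law) auto
  also have "(\<Prod>v\<in>F. pmf (\<kappa> v q (restrict b F)) (restrict b F v)) = (\<Prod>v\<in>F. pmf (\<kappa> v q b) (b v))"
  proof (intro prod.cong refl)
    fix v assume v: "v \<in> F"
    have "\<kappa> v q (restrict b F) = \<kappa> v q b"
      using v assms by (intro \<kappa>_cong) (auto simp: pa_def)
    then show "pmf (\<kappa> v q (restrict b F)) (restrict b F v) = pmf (\<kappa> v q b) (b v)"
      using v by simp
  qed
  finally have 2: "pmf (law F) (q, restrict b F) = pmf L q * (\<Prod>v\<in>F. pmf (\<kappa> v q b) (b v))" .
  have "(\<Prod>v\<in>H. pmf (\<kappa> v q b) (b v)) = (\<Prod>v\<in>H - F. pmf (\<kappa> v q b) (b v)) * (\<Prod>v\<in>F. pmf (\<kappa> v q b) (b v))"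
    using assms finite_V by (intro prod.subset_diff) (auto intro: finite_subset)
  then show ?thesis
    unfolding 1 2 pmf_law[OF assms(1-3)] by simp
qed

lemma joint_alt: "joint = bind_pmf (law V) (\<lambda>(q, a). map_pmf (\<lambda>y. (q, a, y)) (ch q a))"
proof -
  have "filter (\<lambda>v. v \<in> V) ord = ord" by (simp add: filter_id_conv set_ord)
  moreover have "pa S V \<subseteq> V" using S_subset by (auto simp: pa_def)
  ultimately show ?thesis
    by (simp add: joint_def law_alt bind_assoc_pmf bind_map_pmf)
qed

lemma pmf_joint:
  "pmf joint (q, a, y) = pmf (law V) (q, a) * pmf (ch q a) y"
proof -
  have "pmf joint (q, a, y) = pmf (law V) (q, a) * pmf (map_pmf (\<lambda>y. (q, a, y)) (ch q a)) (q, a, y)"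
    unfolding joint_alt by (subst pmf_bind_determined[where \<pi> = "(q, a)"]) auto
  also have "pmf (map_pmf (\<lambda>y. (q, a, y)) (ch q a)) (q, a, y) = pmf (ch q a) y"
    using pmf_map_inj'[of "\<lambda>y. (q, a, y)" "ch q a" y] by (simp add: inj_on_def)
  finally show ?thesis .
qed

section \<open>Averages over the random codebook\<close>

lemma nn_integral_codebook_pair:
  fixes W :: "'v \<Rightarrow> 'm set"
  assumes W: "\<And>v. v \<in> V \<Longrightarrow> finite (W v)"
    and H: "H \<subseteq> V" "pa S H \<subseteq> H"
    and w: "w \<in> PiE V W" and w': "w' \<in> PiE H W"
  defines "F \<equiv> agree H w w'"
  shows "(\<integral>\<^sup>+(q, g). \<phi> q (codewords g w) (restrict (codewords g w') H) \<partial>codebook W) =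
     (\<integral>\<^sup>+q. \<integral>\<^sup>+a. \<integral>\<^sup>+b. \<phi> q a b \<partial>draw (filter (\<lambda>v. v \<in> H - F) ord) q (restrict a F)
        \<partial>draw ord q (\<lambda>_. undefined) \<partial>L)"
proof -
  have FV: "F \<subseteq> H" "F \<subseteq> V" using H by (auto simp: F_def agree_def)
  have undef: "codewords (\<lambda>_ _. undefined) x = (\<lambda>_. undefined)" for x :: "'v \<Rightarrow> 'm"
    by (auto simp: codewords_def)
  \<comment> \<open>All of \<open>V\<close> is still to be drawn, so the second tuple starts with
    the symbols of \<open>F\<close> copied from \<open>a\<close> and nothing else.\<close>
  have init: "(\<lambda>v. if v \<in> F \<inter> set ord then a v
      else restrict (\<lambda>_. undefined) H v) = restrict a F" for a
    using FV by (auto simp: set_ord restrict_def fun_eq_iff)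
  have "(\<integral>\<^sup>+(q, g). \<phi> q (codewords g w) (restrict (codewords g w') H) \<partial>codebook W) =
      (\<integral>\<^sup>+q. \<integral>\<^sup>+(a, b). \<phi> q a b \<partial>map_pmf (\<lambda>g. (codewords g w, restrict (codewords g w') H))
         (draw_codebook W ord q (\<lambda>_ _. undefined)) \<partial>L)"
    by (simp add: codebook_def case_prod_unfold)
  also have "\<dots> = (\<integral>\<^sup>+q. \<integral>\<^sup>+a. \<integral>\<^sup>+b. \<phi> q a b \<partial>draw (filter (\<lambda>v. v \<in> H - F) ord) q (restrict a F)
        \<partial>draw ord q (\<lambda>_. undefined) \<partial>L)"
  proof -
    have "map_pmf (\<lambda>g. (codewords g w, restrict (codewords g w') H)) (draw_codebook W ord q (\<lambda>_ _. undefined)) =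
        bind_pmf (draw ord q (\<lambda>_. undefined)) (\<lambda>a.
          map_pmf (Pair a) (draw (filter (\<lambda>v. v \<in> H - F) ord) q (restrict a F)))" for q
      using codebook_pair[OF W H w w' topological_ord eq_refl[OF set_ord], of q "\<lambda>_ _. undefined"]
      unfolding F_def[symmetric] undef init by blast
    then show ?thesis by simp
  qed
  finally show ?thesis .
qed

lemma nn_integral_codebook_true:
  fixes W :: "'v \<Rightarrow> 'm set"
  assumes W: "\<And>v. v \<in> V \<Longrightarrow> finite (W v)" and w: "w \<in> PiE V W"
  shows "(\<integral>\<^sup>+(q, g). \<integral>\<^sup>+y. \<phi> q (codewords g w) y \<partial>ch q (codewords g w) \<partial>codebook W) =
     (\<integral>\<^sup>+(q, a, y). \<phi> q a y \<partial>joint)"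
proof -
  have "(\<integral>\<^sup>+(q, g). \<integral>\<^sup>+y. \<phi> q (codewords g w) y \<partial>ch q (codewords g w) \<partial>codebook W) =
     (\<integral>\<^sup>+q. \<integral>\<^sup>+a. \<integral>\<^sup>+y. \<phi> q a y \<partial>ch q a \<partial>draw ord q (\<lambda>_. undefined) \<partial>L)"
    \<comment> \<open>With no nodes for the competing tuple, the pair law reduces to the law of the
      transmitted codewords.\<close>
    using nn_integral_codebook_pair[OF W _ _ w, of "{}" "\<lambda>_. undefined"
      "\<lambda>q a b. \<integral>\<^sup>+y. \<phi> q a y \<partial>ch q a"]
    by (simp add: pa_def)
  then show ?thesis by (simp add: joint_def)
qed

text \<open>Given the common codewords of \<open>F\<close>, the output and the other codewords of
  the competing tuple are independent. Relative to this law, \<open>info_ratio\<close> acts as the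
  density of the law in which output and codewords belong together, so its mean is at most
  one.\<close>

lemma nn_integral_codebook_wrong:
  fixes W :: "'v \<Rightarrow> 'm set" and \<rho> :: "'y \<Rightarrow> 'o"
  assumes W: "\<And>v. v \<in> V \<Longrightarrow> finite (W v)"
    and H: "H \<subseteq> V" "pa S H \<subseteq> H"
    and w: "w \<in> PiE V W" and w': "w' \<in> PiE H W"
  defines "F \<equiv> agree H w w'"
  shows "(\<integral>\<^sup>+(q, g). \<integral>\<^sup>+y. ennreal (info_ratio \<rho> H F q (restrict (codewords g w') H) (\<rho> y))
     \<partial>ch q (codewords g w) \<partial>codebook W) \<le> 1"
proof -
  define Ds where "Ds = filter (\<lambda>v. v \<in> H - F) ord"
  define \<nu> where "\<nu> = bind_pmf (law_out \<rho> F) (\<lambda>(q, f, y). map_pmf (\<lambda>b. (q, b, y)) (draw Ds q f))"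
  have F: "pa S F \<subseteq> F" "F \<subseteq> H" using agree_closed[OF H(2)] by (auto simp: F_def agree_def)
  have "(\<integral>\<^sup>+(q, g). \<integral>\<^sup>+y. ennreal (info_ratio \<rho> H F q (restrict (codewords g w') H) (\<rho> y))
      \<partial>ch q (codewords g w) \<partial>codebook W) =
    (\<integral>\<^sup>+q. \<integral>\<^sup>+a. \<integral>\<^sup>+b. \<integral>\<^sup>+y. ennreal (info_ratio \<rho> H F q b (\<rho> y)) \<partial>ch q a
      \<partial>draw Ds q (restrict a F) \<partial>draw ord q (\<lambda>_. undefined) \<partial>L)"
    unfolding Ds_def F_def
    by (rule nn_integral_codebook_pair[OF W H w w', of "\<lambda>q a b. \<integral>\<^sup>+y. ennreal (info_ratio \<rho> H _ q b (\<rho> y)) \<partial>ch q a"])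
  also have "\<dots> = (\<integral>\<^sup>+(q, b, y). ennreal (info_ratio \<rho> H F q b y)
      \<partial>bind_pmf L (\<lambda>q. bind_pmf (draw ord q (\<lambda>_. undefined)) (\<lambda>a.
        bind_pmf (draw Ds q (restrict a F)) (\<lambda>b. bind_pmf (ch q a) (\<lambda>y. return_pmf (q, b, \<rho> y))))))"
    by simp
  \<comment> \<open>Drawing the output before the competing codewords shows that these depend on the
    transmitted ones through \<open>F\<close> only.\<close>
  also have "bind_pmf L (\<lambda>q. bind_pmf (draw ord q (\<lambda>_. undefined)) (\<lambda>a.
        bind_pmf (draw Ds q (restrict a F)) (\<lambda>b. bind_pmf (ch q a) (\<lambda>y. return_pmf (q, b, \<rho> y))))) = \<nu>"
    unfolding \<nu>_def law_out_def joint_def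
    by (subst bind_commute_pmf) (simp add: map_pmf_def bind_assoc_pmf bind_return_pmf)
  also have "(\<integral>\<^sup>+(q, b, y). ennreal (info_ratio \<rho> H F q b y) \<partial>\<nu>) =
      (\<integral>\<^sup>+x. ennreal (pmf \<nu> x) * (case x of (q, b, y) \<Rightarrow> ennreal (info_ratio \<rho> H F q b y)) \<partial>count_space UNIV)"
    by (rule nn_integral_measure_pmf)
  also have "\<dots> \<le> (\<integral>\<^sup>+x. ennreal (pmf (law_out \<rho> H) x) \<partial>count_space UNIV)"
  proof (rule nn_integral_mono)
    fix x :: "'q \<times> ('v \<Rightarrow> 'u) \<times> 'o"
    obtain q b y where x: "x = (q, b, y)" by (cases x) auto
    have fext: "f \<in> extensional F" if "(q, f, y) \<in> set_pmf (law_out \<rho> F)" for q f y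
      using that by (auto simp: law_out_def)
    have bf: "f = restrict b F" "b \<in> extensional H"
      if f: "(q, f, y) \<in> set_pmf (law_out \<rho> F)" and b: "b \<in> set_pmf (draw Ds q f)" for q f b y
    proof -
      have bv: "b v = f v" if "v \<notin> H - F" for v
        using draw_unchanged[OF b, of v] that by (auto simp: Ds_def)
      then show "b \<in> extensional H"
        using fext[OF f] bv F(2) by (auto simp: extensional_def)
      show "f = restrict b F"
        using fext[OF f] bv by (auto simp: extensional_def restrict_def)
    qed
    have \<nu>: "pmf \<nu> x = pmf (law_out \<rho> F) (q, restrict b F, y) * pmf (draw Ds q (restrict b F)) b"
    proof -
      have "pmf \<nu> x = pmf (law_out \<rho> F) (q, restrict b F, y) *
          pmf (map_pmf (\<lambda>b. (q, b, y)) (draw Ds q (restrict b F))) x"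
        unfolding \<nu>_def x by (subst pmf_bind_determined[where \<pi> = "(q, restrict b F, y)"]) (auto dest: bf)
      also have "pmf (map_pmf (\<lambda>b. (q, b, y)) (draw Ds q (restrict b F))) x = pmf (draw Ds q (restrict b F)) b"
        unfolding x using pmf_map_inj'[of "\<lambda>b. (q, b, y)" "draw Ds q (restrict b F)" b]
        by (simp add: inj_on_def)
      finally show ?thesis .
    qed
    \<comment> \<open>By the chain rule the denominator of \<open>info_ratio\<close> is
      \<open>pmf \<nu> x\<close> times the probability of u_F and q, which cancels against the
      numerator. Where it vanishes the quotient is 0, hence only an inequality.\<close>
    have "pmf \<nu> x * info_ratio \<rho> H F q b y \<le> pmf (law_out \<rho> H) x"
    proof (cases "pmf (law_out \<rho> F) (q, restrict b F, y) = 0 \<or> pmf (draw Ds q (restrict b F)) b = 0")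
      case True
      then show ?thesis by (auto simp: \<nu>)
    next
      case False
      then have b: "b \<in> extensional H" by (intro bf(2)) (auto simp: set_pmf_iff)
      show ?thesis
        using False pmf_law_chain[OF H(2,1) b F, of q, folded Ds_def]
        by (auto simp: info_ratio_def \<nu>[unfolded x] x field_simps)
    qed
    then show "ennreal (pmf \<nu> x) * (case x of (q, b, y) \<Rightarrow> ennreal (info_ratio \<rho> H F q b y)) \<le>
        ennreal (pmf (law_out \<rho> H) x)"
      by (simp add: x ennreal_mult''[symmetric] info_ratio_nonneg ennreal_leI)
  qed
  also have "\<dots> = 1" by (simp add: nn_integral_pmf)
  finally show ?thesis .
qed

end

section \<open>Threshold tests on a block\<close>

text \<open>As a function of \<open>s\<close> the moment has value 1 and derivative - E ln h < 0 at
  s = 0, so it drops below 1 to the right of 0.\<close>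

lemma exists_negative_moment_lt_1:
  fixes h :: "'a \<Rightarrow> real"
  assumes fin: "finite (set_pmf p)" and pos: "\<And>x. x \<in> set_pmf p \<Longrightarrow> 0 < h x"
    and mean: "0 < measure_pmf.expectation p (\<lambda>x. ln (h x))"
  shows "\<exists>s>0. measure_pmf.expectation p (\<lambda>x. h x powr (- s)) < 1"
proof -
  define G where "G = (\<lambda>s. \<Sum>x\<in>set_pmf p. pmf p x * h x powr (- s))"
  have G: "measure_pmf.expectation p (\<lambda>x. h x powr (- s)) = G s" for s
    using fin by (subst integral_measure_pmf_real[where A = "set_pmf p"]) (auto simp: G_def mult.commute)
  \<comment> \<open>Positivity of \<open>h\<close> matters even at s = 0, because
    \<open>0 powr 0 = 0\<close>.\<close>
  have G0: "G 0 = 1"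
  proof -
    have "G 0 = (\<Sum>x\<in>set_pmf p. pmf p x)"
      unfolding G_def using pos by (intro sum.cong) (force simp: powr_def)+
    then show ?thesis using fin by (simp add: sum_pmf_eq_1)
  qed
  have "(G has_real_derivative (\<Sum>x\<in>set_pmf p. pmf p x * (- ln (h x)))) (at 0)"
    unfolding G_def
  proof (intro DERIV_sum)
    fix x assume "x \<in> set_pmf p"
    then show "((\<lambda>s. pmf p x * h x powr (- s)) has_real_derivative pmf p x * (- ln (h x))) (at 0)"
      using pos[of x] by (auto simp: powr_def intro!: derivative_eq_intros)
  qed
  moreover have "(\<Sum>x\<in>set_pmf p. pmf p x * (- ln (h x))) = - measure_pmf.expectation p (\<lambda>x. ln (h x))"
    using fin by (subst integral_measure_pmf_real[where A = "set_pmf p"])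
      (auto simp: mult.commute sum_negf)
  ultimately have "\<exists>d>0. \<forall>s>0. s < d \<longrightarrow> G (0 + s) < G 0"
    using mean by (intro DERIV_neg_dec_right) auto
  then obtain d where d: "d > 0" "\<And>s. s > 0 \<Longrightarrow> s < d \<Longrightarrow> G s < 1"
    using G0 by auto
  then show ?thesis
    by (intro exI[of _ "d / 2"]) (simp add: G)
qed

text \<open>The value \<open>\<top>\<close> at \<open>0\<close> corrects the junk value \<open>0 powr (- s) = 0\<close>.\<close>

definition pow_inv :: "real \<Rightarrow> real \<Rightarrow> ennreal" where
  "pow_inv s x = (if 0 < x then ennreal (x powr (- s)) else \<top>)"

text \<open>A positive product below 1 has a negative power of at least 1; a vanishing factor
  contributes \<top>.\<close>

lemma prod_pow_inv_ge_1:
  assumes "finite A" and nn: "\<And>t. t \<in> A \<Longrightarrow> 0 \<le> x t" and less: "(\<Prod>t\<in>A. x t) < 1" and s: "s > 0"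
  shows "1 \<le> (\<Prod>t\<in>A. pow_inv s (x t))"
proof (cases "\<forall>t\<in>A. 0 < x t")
  case True
  have "(\<Prod>t\<in>A. pow_inv s (x t)) = (\<Prod>t\<in>A. ennreal (x t powr (- s)))"
    using True by (intro prod.cong) (auto simp: pow_inv_def)
  also have "\<dots> = ennreal (\<Prod>t\<in>A. x t powr (- s))"
    by (rule prod_ennreal) auto
  also have "(\<Prod>t\<in>A. x t powr (- s)) = (\<Prod>t\<in>A. x t) powr (- s)"
    using nn by (simp add: prod_powr_distrib)
  also have "1 \<le> ennreal \<dots>"
  proof -
    have "0 < (\<Prod>t\<in>A. x t)" using True by (intro prod_pos) auto
    then have "1 \<le> (\<Prod>t\<in>A. x t) powr (- s)"
      using less s powr_le1[of s "\<Prod>t\<in>A. x t"] by (simp add: powr_minus one_le_inverse)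
    then show ?thesis by (metis ennreal_1 ennreal_leI)
  qed
  finally show ?thesis .
next
  case False
  \<comment> \<open>In \<open>ennreal\<close> the product of 0 and \<top> is 0, so all other factors
    have to be nonzero.\<close>
  have "pow_inv s (x t) \<noteq> 0" for t by (auto simp: pow_inv_def)
  then have "(\<Prod>t\<in>A. pow_inv s (x t)) = \<top>"
    using False assms(1) by (subst ennreal_prod_eq_top) (auto simp: pow_inv_def)
  then show ?thesis by simp
qed

text \<open>A fresh codebook is drawn at every time instant, independently over time, and the
  channel is memoryless given the codebooks; in the applications \<open>ch\<close> has the
  transmitted message tuple built in.\<close>

definition block_law :: "nat \<Rightarrow> 'c pmf \<Rightarrow> ('c \<Rightarrow> 'y pmf) \<Rightarrow> ((nat \<Rightarrow> 'c) \<times> (nat \<Rightarrow> 'y)) pmf" where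
  "block_law n K ch =
     bind_pmf (Pi_pmf {..<n} undefined (\<lambda>_. K)) (\<lambda>C.
       map_pmf (Pair C) (Pi_pmf {..<n} undefined (\<lambda>t. ch (C t))))"

text \<open>On \<open>E\<close> the product dominates the indicator, and its mean factorizes because
  the time instants are independent.\<close>

lemma block_law_Markov:
  assumes "\<And>C y. (C, y) \<in> E \<Longrightarrow> 1 \<le> (\<Prod>t<n. \<phi> (C t) (y t))"
  shows "emeasure (block_law n K ch) E \<le> (\<integral>\<^sup>+c. \<integral>\<^sup>+y. \<phi> c y \<partial>ch c \<partial>K) ^ n"
proof -
  have "emeasure (block_law n K ch) E = (\<integral>\<^sup>+x. indicator E x \<partial>block_law n K ch)"
    by simp
  also have "\<dots> \<le> (\<integral>\<^sup>+(C, y). (\<Prod>t<n. \<phi> (C t) (y t)) \<partial>block_law n K ch)"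
    using assms by (intro nn_integral_mono) (auto simp: indicator_def)
  also have "\<dots> = (\<integral>\<^sup>+C. \<integral>\<^sup>+y. (\<Prod>t<n. \<phi> (C t) (y t)) \<partial>Pi_pmf {..<n} undefined (\<lambda>t. ch (C t))
      \<partial>Pi_pmf {..<n} undefined (\<lambda>_. K))"
    by (simp add: block_law_def)
  also have "\<dots> = (\<integral>\<^sup>+C. (\<Prod>t<n. \<integral>\<^sup>+y. \<phi> (C t) y \<partial>ch (C t)) \<partial>Pi_pmf {..<n} undefined (\<lambda>_. K))"
    by (subst nn_integral_prod_Pi_pmf) auto
  also have "\<dots> = (\<Prod>t<n. \<integral>\<^sup>+c. \<integral>\<^sup>+y. \<phi> c y \<partial>ch c \<partial>K)"
    by (rule nn_integral_prod_Pi_pmf) auto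
  finally show ?thesis by simp
qed

section \<open>Error bounds for the threshold test\<close>

context superposition_channel
begin

lemma info_ratio_pos:
  assumes "(q, a, y) \<in> set_pmf joint" "F \<subseteq> H"
  shows "0 < info_ratio \<rho> H F q (restrict a H) (\<rho> y)"
proof -
  have *: "pmf (map_pmf f joint) (f (q, a, y)) > 0" for f :: "_ \<Rightarrow> 'c"
    using assms(1) by (simp add: pmf_positive)
  have "restrict (restrict a H) F = restrict a F"
    using assms(2) by (simp add: restrict_restrict Int_absorb1)
  then show ?thesis
    using *[of "\<lambda>(q, a, y). (q, restrict a H)"] *[of "\<lambda>(q, a, y). (q, restrict a F)"]
      *[of "\<lambda>(q, a, y). (q, restrict a H, \<rho> y)"] *[of "\<lambda>(q, a, y). (q, restrict a F, \<rho> y)"]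
    by (simp add: info_ratio_def law_def law_out_def)
qed

text \<open>The threshold \<open>2 powr (real n * \<gamma> F)\<close> is spread over the
  \<open>n\<close> factors, which gives the product form of \<open>block_law_Markov\<close>.\<close>

definition passes ::
  "nat \<Rightarrow> ('y \<Rightarrow> 'o) \<Rightarrow> 'v set \<Rightarrow> 'v set set \<Rightarrow> ('v set \<Rightarrow> real) \<Rightarrow>
   (nat \<Rightarrow> 'q \<times> ('v \<Rightarrow> ('v \<Rightarrow> 'm) \<Rightarrow> 'u)) \<Rightarrow> (nat \<Rightarrow> 'o) \<Rightarrow> ('v \<Rightarrow> 'm) \<Rightarrow> bool" where
  "passes n \<rho> H \<F> \<gamma> C ys w \<longleftrightarrow>
     (\<forall>F\<in>\<F>. 1 \<le> (\<Prod>t<n. info_ratio \<rho> H F (fst (C t)) (restrict (codewords (snd (C t)) w) H) (ys t)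
        * 2 powr (- \<gamma> F)))"

text \<open>Union bound over the tests; each failure is bounded by Markov's inequality for the power
  \<open>- s F\<close> of the test product.\<close>

lemma passes_true_bound:
  fixes W :: "'v \<Rightarrow> 'm set" and \<rho> :: "'y \<Rightarrow> 'o"
  assumes W: "\<And>v. v \<in> V \<Longrightarrow> finite (W v)"
    and H: "H \<subseteq> V" "pa S H \<subseteq> H"
    and w: "w \<in> PiE V W" and F: "finite \<F>" "\<And>F. F \<in> \<F> \<Longrightarrow> F \<subseteq> H"
    and fin: "finite (set_pmf joint)" and s: "\<And>F. F \<in> \<F> \<Longrightarrow> s F > 0"
  shows "emeasure (block_law n (codebook W) (\<lambda>(q, g). ch q (codewords g w)))
      {(C, y). \<not> passes n \<rho> H \<F> \<gamma> C (\<lambda>t. \<rho> (y t)) (restrict w H)} \<le>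
    (\<Sum>F\<in>\<F>. ennreal (measure_pmf.expectation joint (\<lambda>(q, a, y).
       (info_ratio \<rho> H F q (restrict a H) (\<rho> y) * 2 powr (- \<gamma> F)) powr (- s F))) ^ n)"
proof -
  define x where "x = (\<lambda>F C (y :: 'y). info_ratio \<rho> H F (fst C) (restrict (codewords (snd C) w) H) (\<rho> y)
        * 2 powr (- \<gamma> F))"
  have cw: "restrict (codewords g (restrict w H)) H = restrict (codewords g w) H" for g :: "'v \<Rightarrow> ('v \<Rightarrow> 'm) \<Rightarrow> 'u"
    by (rule restrict_ext) (rule codewords_restrict[OF H(2)])
  let ?N = "block_law n (codebook W) (\<lambda>(q, g). ch q (codewords g w))"
  have "{(C, y). \<not> passes n \<rho> H \<F> \<gamma> C (\<lambda>t. \<rho> (y t)) (restrict w H)} =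
      (\<Union>F\<in>\<F>. {(C, y). (\<Prod>t<n. x F (C t) (y t)) < 1})"
    by (auto simp: passes_def x_def cw not_le)
  also have "emeasure ?N \<dots> \<le> (\<Sum>F\<in>\<F>. emeasure ?N {(C, y). (\<Prod>t<n. x F (C t) (y t)) < 1})"
    using F(1) by (intro emeasure_subadditive_finite) auto
  also have "\<dots> \<le> (\<Sum>F\<in>\<F>. ennreal (measure_pmf.expectation joint (\<lambda>(q, a, y).
       (info_ratio \<rho> H F q (restrict a H) (\<rho> y) * 2 powr (- \<gamma> F)) powr (- s F))) ^ n)"
  proof (intro sum_mono)
    fix F assume FF: "F \<in> \<F>"
    have "emeasure ?N {(C, y). (\<Prod>t<n. x F (C t) (y t)) < 1} \<le>
        (\<integral>\<^sup>+c. \<integral>\<^sup>+y. pow_inv (s F) (x F c y) \<partial>(case c of (q, g) \<Rightarrow> ch q (codewords g w)) \<partial>codebook W) ^ n"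
      using s[OF FF] by (intro block_law_Markov) (auto intro!: prod_pow_inv_ge_1 simp: x_def info_ratio_nonneg)
    also have "(\<integral>\<^sup>+c. \<integral>\<^sup>+y. pow_inv (s F) (x F c y) \<partial>(case c of (q, g) \<Rightarrow> ch q (codewords g w)) \<partial>codebook W) =
        (\<integral>\<^sup>+(q, g). \<integral>\<^sup>+y. pow_inv (s F) (info_ratio \<rho> H F q (restrict (codewords g w) H) (\<rho> y)
          * 2 powr (- \<gamma> F)) \<partial>ch q (codewords g w) \<partial>codebook W)"
      by (simp add: x_def case_prod_unfold)
    also have "\<dots> = (\<integral>\<^sup>+(q, a, y). pow_inv (s F) (info_ratio \<rho> H F q (restrict a H) (\<rho> y)
          * 2 powr (- \<gamma> F)) \<partial>joint)"
      by (rule nn_integral_codebook_true[OF W w])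
    \<comment> \<open>Under \<open>joint\<close> the ratio is positive almost surely, so the value
      \<top> of \<open>pow_inv\<close> is never met.\<close>
    also have "\<dots> = (\<integral>\<^sup>+z. ennreal (case z of (q, a, y) \<Rightarrow> (info_ratio \<rho> H F q (restrict a H) (\<rho> y)
          * 2 powr (- \<gamma> F)) powr (- s F)) \<partial>joint)"
      using info_ratio_pos[OF _ F(2)[OF FF]]
      by (intro nn_integral_cong_AE) (auto simp: AE_measure_pmf_iff pow_inv_def intro!: mult_pos_pos)
    also have "\<dots> = ennreal (measure_pmf.expectation joint (\<lambda>(q, a, y).
       (info_ratio \<rho> H F q (restrict a H) (\<rho> y) * 2 powr (- \<gamma> F)) powr (- s F)))"
      using fin by (intro nn_integral_eq_integral integrable_measure_pmf_finite)
        (auto simp: case_prod_unfold)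
    finally show "emeasure ?N {(C, y). (\<Prod>t<n. x F (C t) (y t)) < 1} \<le> \<dots> ^ n" .
  qed
  finally show ?thesis .
qed

text \<open>Union bound over the competing tuples, grouped by agreement set \<open>F\<close>. Each
  is judged by the test for its own \<open>F\<close> alone, which it passes with probability at most
  \<open>2 powr (- real n * \<gamma> F)\<close> because the ratio has mean at most one.\<close>

lemma passes_wrong_bound:
  fixes W :: "'v \<Rightarrow> 'm set" and \<rho> :: "'y \<Rightarrow> 'o"
  assumes W: "\<And>v. v \<in> V \<Longrightarrow> finite (W v)"
    and H: "H \<subseteq> V" "pa S H \<subseteq> H"
    and w: "w \<in> PiE V W" and F: "finite \<F>"
    and agree: "\<And>w'. w' \<in> PiE H W \<Longrightarrow> w' \<noteq> restrict w H \<Longrightarrow> agree H w w' \<in> \<F>"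
  shows "emeasure (block_law n (codebook W) (\<lambda>(q, g). ch q (codewords g w)))
      {(C, y). \<exists>w'\<in>PiE H W. w' \<noteq> restrict w H \<and> passes n \<rho> H \<F> \<gamma> C (\<lambda>t. \<rho> (y t)) w'} \<le>
    (\<Sum>F\<in>\<F>. ennreal (real (\<Prod>v\<in>H - F. card (W v)) * 2 powr (- real n * \<gamma> F)))"
proof -
  let ?N = "block_law n (codebook W) (\<lambda>(q, g). ch q (codewords g w))"
  define X where "X = PiE H W - {restrict w H}"
  define P where "P = (\<lambda>w' :: 'v \<Rightarrow> 'm. {(C, y). passes n \<rho> H \<F> \<gamma> C (\<lambda>t. \<rho> (y t)) w'})"
  have finH: "finite H" using H(1) finite_V finite_subset by blast
  have finX: "finite (PiE H W)" using finH H W by (intro finite_PiE) auto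
  have one: "emeasure ?N (P w') \<le> ennreal (2 powr (- real n * \<gamma> (agree H w w')))" if w': "w' \<in> X" for w'
  proof -
    define F where "F = agree H w w'"
    have FF: "F \<in> \<F>" using agree w' by (auto simp: X_def F_def)
    have wH: "w' \<in> PiE H W" using w' by (simp add: X_def)
    define x where "x = (\<lambda>C (y :: 'y). info_ratio \<rho> H F (fst C) (restrict (codewords (snd C) w') H) (\<rho> y)
        * 2 powr (- \<gamma> F))"
    have "emeasure ?N (P w') \<le>
        (\<integral>\<^sup>+c. \<integral>\<^sup>+y. ennreal (x c y) \<partial>(case c of (q, g) \<Rightarrow> ch q (codewords g w)) \<partial>codebook W) ^ n"
    proof (rule block_law_Markov)
      fix C y assume "(C, y) \<in> P w'"
      then have "1 \<le> (\<Prod>t<n. x (C t) (y t))" using FF by (auto simp: P_def passes_def x_def)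
      then have "1 \<le> ennreal (\<Prod>t<n. x (C t) (y t))" by (metis ennreal_1 ennreal_leI)
      then show "1 \<le> (\<Prod>t<n. ennreal (x (C t) (y t)))"
        by (subst prod_ennreal) (auto simp: x_def info_ratio_nonneg)
    qed
    also have "(\<integral>\<^sup>+c. \<integral>\<^sup>+y. ennreal (x c y) \<partial>(case c of (q, g) \<Rightarrow> ch q (codewords g w)) \<partial>codebook W) =
        (\<integral>\<^sup>+(q, g). \<integral>\<^sup>+y. ennreal (info_ratio \<rho> H F q (restrict (codewords g w') H) (\<rho> y))
          \<partial>ch q (codewords g w) \<partial>codebook W) * ennreal (2 powr (- \<gamma> F))"
      by (simp add: x_def case_prod_unfold ennreal_mult info_ratio_nonneg nn_integral_multc)
    also have "\<dots> \<le> 1 * ennreal (2 powr (- \<gamma> F))"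
      unfolding F_def by (intro mult_right_mono nn_integral_codebook_wrong W H w wH) auto
    finally have "emeasure ?N (P w') \<le> ennreal (2 powr (- \<gamma> F)) ^ n"
      by (simp add: power_mono)
    also have "\<dots> = ennreal (2 powr (- real n * \<gamma> F))"
      by (simp add: ennreal_power powr_power mult.commute)
    finally show ?thesis by (simp add: F_def)
  qed
  \<comment> \<open>On \<open>F\<close> a tuple with agreement set \<open>F\<close> equals
    \<open>w\<close>, so its coordinates outside \<open>F\<close> determine it.\<close>
  have count: "real (card {w' \<in> X. agree H w w' = F}) \<le> real (\<Prod>v\<in>H - F. card (W v))" for F
  proof -
    have "inj_on (\<lambda>w'. restrict w' (H - F)) {w' \<in> X. agree H w w' = F}"
    proof (rule inj_onI)
      fix a b assume a: "a \<in> {w' \<in> X. agree H w w' = F}" and b: "b \<in> {w' \<in> X. agree H w w' = F}"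
        and eq: "restrict a (H - F) = restrict b (H - F)"
      have "a v = b v" for v
      proof -
        consider "v \<in> F" | "v \<in> H - F" | "v \<notin> H"
          by blast
        then show ?thesis
        proof cases
          case 1
          then have "v \<in> agree H w a" "v \<in> agree H w b" using a b by auto
          then show ?thesis by (auto simp: agree_def anc_def)
        next
          case 2
          then show ?thesis using fun_cong[OF eq, of v] by simp
        next
          case 3
          moreover have "a \<in> PiE H W" "b \<in> PiE H W" using a b by (simp_all add: X_def)
          ultimately show ?thesis using PiE_arb[of a H W v] PiE_arb[of b H W v] by simp
        qed
      qed
      then show "a = b" by auto
    qed
    moreover have "(\<lambda>w'. restrict w' (H - F)) ` {w' \<in> X. agree H w w' = F} \<subseteq> PiE (H - F) W"
      by (auto simp: X_def)
    moreover have "finite (PiE (H - F) W)" using finH H W by (intro finite_PiE) auto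
    ultimately have "card {w' \<in> X. agree H w w' = F} \<le> card (PiE (H - F) W)"
      by (rule card_inj_on_le)
    also have "\<dots> = (\<Prod>v\<in>H - F. card (W v))" using finH by (intro card_PiE) auto
    finally show ?thesis by (simp only: of_nat_le_iff)
  qed
  have "{(C, y). \<exists>w'\<in>PiE H W. w' \<noteq> restrict w H \<and> passes n \<rho> H \<F> \<gamma> C (\<lambda>t. \<rho> (y t)) w'} = (\<Union>w'\<in>X. P w')"
    by (auto simp: X_def P_def)
  also have "emeasure ?N \<dots> \<le> (\<Sum>w'\<in>X. emeasure ?N (P w'))"
    using finX by (intro emeasure_subadditive_finite) (auto simp: X_def)
  also have "\<dots> \<le> (\<Sum>w'\<in>X. ennreal (2 powr (- real n * \<gamma> (agree H w w'))))"
    by (intro sum_mono one)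
  also have "\<dots> = (\<Sum>F\<in>\<F>. \<Sum>w' | w' \<in> X \<and> agree H w w' = F. ennreal (2 powr (- real n * \<gamma> (agree H w w'))))"
    using finX F agree by (intro sum.group[symmetric]) (auto simp: X_def)
  also have "\<dots> \<le> (\<Sum>F\<in>\<F>. ennreal (real (\<Prod>v\<in>H - F. card (W v)) * 2 powr (- real n * \<gamma> F)))"
  proof (intro sum_mono)
    fix F
    have "(\<Sum>w' | w' \<in> X \<and> agree H w w' = F. ennreal (2 powr (- real n * \<gamma> (agree H w w')))) =
        ennreal (real (card {w' \<in> X. agree H w w' = F}) * 2 powr (- real n * \<gamma> F))"
      by (simp add: ennreal_mult ennreal_of_nat_eq_real_of_nat)
    also have "\<dots> \<le> ennreal (real (\<Prod>v\<in>H - F. card (W v)) * 2 powr (- real n * \<gamma> F))"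
      by (intro ennreal_leI mult_right_mono count) auto
    finally show "(\<Sum>w' | w' \<in> X \<and> agree H w w' = F. ennreal (2 powr (- real n * \<gamma> (agree H w w')))) \<le> \<dots>" .
  qed
  finally show ?thesis .
qed

end

section \<open>Achievability in the interior\<close>

lemma nn_integral_pmf_commute:
  "(\<integral>\<^sup>+x. \<integral>\<^sup>+y. f x y \<partial>measure_pmf q \<partial>measure_pmf p) = (\<integral>\<^sup>+y. \<integral>\<^sup>+x. f x y \<partial>measure_pmf p \<partial>measure_pmf q)"
proof -
  have "(\<integral>\<^sup>+(x, y). f x y \<partial>bind_pmf p (\<lambda>x. bind_pmf q (\<lambda>y. return_pmf (x, y)))) =
      (\<integral>\<^sup>+(x, y). f x y \<partial>bind_pmf q (\<lambda>y. bind_pmf p (\<lambda>x. return_pmf (x, y))))"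
    by (subst bind_commute_pmf) simp
  then show ?thesis by simp
qed

text \<open>The first-moment method: if all values exceeded \<open>c\<close>, the mean could not be
  at most \<open>b\<close>.\<close>

lemma ex_le_nn_integral_pmf:
  assumes "(\<integral>\<^sup>+x. f x \<partial>measure_pmf p) \<le> ennreal b" "b < c"
  shows "\<exists>x. f x \<le> ennreal c"
proof (rule ccontr)
  assume *: "\<nexists>x. f x \<le> ennreal c"
  have "ennreal c = (\<integral>\<^sup>+x. ennreal c \<partial>measure_pmf p)"
    by (simp add: measure_pmf.emeasure_space_1)
  also have "\<dots> \<le> (\<integral>\<^sup>+x. f x \<partial>measure_pmf p)"
    using * by (intro nn_integral_mono) (auto simp: not_le less_imp_le)
  also have "\<dots> \<le> ennreal b" by fact
  \<comment> \<open>Negative reals become 0 in \<open>ennreal\<close>, so this case survives; the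
    mean is then 0 and \<open>f\<close> vanishes on the support.\<close>
  finally have c: "c \<le> 0" using assms(2) by (simp add: ennreal_le_iff2)
  then have "(\<integral>\<^sup>+x. f x \<partial>measure_pmf p) = 0"
    using assms by (simp add: ennreal_neg)
  then have "AE x in measure_pmf p. f x = 0"
    by (simp add: nn_integral_0_iff_AE)
  moreover obtain x where "x \<in> set_pmf p"
    using set_pmf_not_empty[of p] by blast
  ultimately have "f x = 0" by (simp add: AE_measure_pmf_iff)
  then have "f x \<le> ennreal c" by simp
  then show False using * by blast
qed

text \<open>The containment conditions on edges enter here and in \<open>pa_known_at\<close>: a
  bottom message is decoded, and known, wherever the messages above it are.\<close>

lemma pa_decoded_at: "superposition_graph V S \<Longrightarrow> pa S (decoded_at V z) \<subseteq> decoded_at V z"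
  unfolding superposition_graph_def pa_def decoded_at_def by fastforce

lemma pa_known_at:
  assumes "superposition_graph V S" shows "pa S (known_at V k) \<subseteq> known_at V k"
  using assms unfolding superposition_graph_def pa_def known_at_def by fastforce

text \<open>Rounding up at most doubles a number that is at least 1, which leaves exponents
  unaffected.\<close>

lemma num_messages_le: "0 \<le> r \<Longrightarrow> real (num_messages n r) \<le> 2 * 2 powr (real n * r)"
proof -
  assume "0 \<le> r"
  then have "1 \<le> 2 powr (real n * r)" by (intro ge_one_powr_ge_zero) auto
  then show ?thesis unfolding num_messages_def by linarith
qed

lemma num_messages_pos: "0 < num_messages n r"
  by (simp add: num_messages_def)

text \<open>Competing tuples can therefore never differ from the transmitted one in a message of
  rate zero.\<close>

lemma num_messages_0: "num_messages n 0 = 1"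
  by (simp add: num_messages_def)

section \<open>Encoders, decoders and the random coding error\<close>

locale superposition_network = superposition_channel S V \<kappa> L ch
  for S :: "(('tx::finite, 'rx::finite) node \<times> ('tx, 'rx) node) set" and V
    and \<kappa> :: "('tx, 'rx) node \<Rightarrow> 'q \<Rightarrow> (('tx, 'rx) node \<Rightarrow> 'u) \<Rightarrow> 'u pmf"
    and L and ch :: "'q \<Rightarrow> (('tx, 'rx) node \<Rightarrow> 'u) \<Rightarrow> ('rx \<Rightarrow> 'y) pmf" +
  fixes A :: "'tx \<Rightarrow> 'x set" and P :: "('tx \<Rightarrow> 'x) \<Rightarrow> ('rx \<Rightarrow> 'y) pmf"
    and inp :: "'tx \<Rightarrow> 'q \<Rightarrow> (('tx, 'rx) node \<Rightarrow> 'u) \<Rightarrow> 'x"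
  assumes graph: "superposition_graph V S"
    and inp_in: "\<And>k q u. inp k q u \<in> A k"
    and ch_eq: "\<And>q u. ch q u = P (\<lambda>k. inp k q (restrict u (known_at V k)))"
    and finite_joint: "finite (set_pmf joint)"
begin

text \<open>Identified in the final proof with the conditional mutual information that bounds the
  rates outside \<open>F\<close>.\<close>

definition info :: "'rx \<Rightarrow> (('tx, 'rx) node) set \<Rightarrow> real" where
  "info z F = measure_pmf.expectation joint (\<lambda>(q, a, y).
     log 2 (info_ratio (\<lambda>y. y z) (decoded_at V z) F q (restrict a (decoded_at V z)) (y z)))"

text \<open>\<open>C t\<close> holds the time-sharing value and the codebook of time
  \<open>t\<close>, shared by all terminals. The outer restriction discards the meaningless
  codewords at nodes whose messages transmitter \<open>k\<close> does not know.\<close>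

definition encoder :: "(nat \<Rightarrow> 'q \<times> (('tx, 'rx) node \<Rightarrow> (('tx, 'rx) node \<Rightarrow> nat) \<Rightarrow> 'u)) \<Rightarrow>
    ('tx, 'rx, 'x) encoders" where
  "encoder C k w t = inp k (fst (C t)) (restrict (codewords (snd (C t)) w) (known_at V k))"

text \<open>The known nodes are parent-closed, so the known messages yield the true codewords
  there.\<close>

lemma transmit_encoder:
  "transmit V P n (encoder C) w =
     Pi_pmf {..<n} undefined (\<lambda>t. (\<lambda>(q, g). ch q (codewords g w)) (C t))"
proof -
  have "restrict (codewords g (restrict w (known_at V k))) (known_at V k) =
      restrict (codewords g w) (known_at V k)" for g k
    by (rule restrict_ext) (rule codewords_restrict[OF pa_known_at[OF graph]])
  then show ?thesis
    unfolding transmit_def by (intro Pi_pmf_cong refl) (simp add: encoder_def ch_eq case_prod_unfold)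
qed

definition decoder where
  "decoder n W \<F> \<gamma> C z v ys =
     (SOME w. w \<in> PiE (decoded_at V z) W \<and> passes n (\<lambda>y. y z) (decoded_at V z) (\<F> z) (\<gamma> z) C ys w) v"

definition failure where
  "failure n W \<F> \<gamma> z w =
     {(C, y). \<not> passes n (\<lambda>y. y z) (decoded_at V z) (\<F> z) (\<gamma> z) C (\<lambda>t. y t z) (restrict w (decoded_at V z))}
     \<union> {(C, y). \<exists>w'\<in>PiE (decoded_at V z) W. w' \<noteq> restrict w (decoded_at V z) \<and>
          passes n (\<lambda>y. y z) (decoded_at V z) (\<F> z) (\<gamma> z) C (\<lambda>t. y t z) w'}"

text \<open>Outside \<open>failure\<close> the transmitted tuple is the only one that passes, so the
  choice by \<open>SOME\<close> is forced.\<close>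

lemma decoder_correct:
  assumes "(C, y) \<notin> failure n W \<F> \<gamma> z w" "w \<in> PiE V W" "v \<in> decoded_at V z"
  shows "decoder n W \<F> \<gamma> C z v (\<lambda>t\<in>{..<n}. y t z) = w v"
proof -
  let ?H = "decoded_at V z"
  \<comment> \<open>The test reads only the times before \<open>n\<close>, where the truncated
    outputs are unchanged.\<close>
  have eq: "passes n (\<lambda>y. y z) ?H (\<F> z) (\<gamma> z) C (\<lambda>t\<in>{..<n}. y t z) w' \<longleftrightarrow>
      passes n (\<lambda>y. y z) ?H (\<F> z) (\<gamma> z) C (\<lambda>t. y t z) w'" for w'
    by (simp add: passes_def)
  have "restrict w ?H \<in> PiE ?H W" using assms(2) by (auto simp: decoded_at_def)
  then have "(SOME w. w \<in> PiE ?H W \<and> passes n (\<lambda>y. y z) ?H (\<F> z) (\<gamma> z) C (\<lambda>t\<in>{..<n}. y t z) w)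
      = restrict w ?H"
    unfolding eq using assms(1) by (intro some_equality) (auto simp: failure_def)
  then show ?thesis using assms(3) by (simp add: decoder_def)
qed

text \<open>Strict inequality is asked only for positive rate sums: a zero sum may face zero mutual
  information, but then no competing tuple has this agreement set.\<close>

theorem achievable_interior:
  assumes R: "R \<in> rate_vectors V"
    and less: "\<And>z F. F \<subseteq> decoded_at V z \<Longrightarrow> pa S F \<subseteq> F \<Longrightarrow> 0 < (\<Sum>v\<in>decoded_at V z - F. R $ v) \<Longrightarrow>
      (\<Sum>v\<in>decoded_at V z - F. R $ v) < info z F"
  shows "achievable V A P R"
proof -
  let ?H = "decoded_at V"
  have H: "?H z \<subseteq> V" "pa S (?H z) \<subseteq> ?H z" "finite (?H z)" for z
    using pa_decoded_at[OF graph] by (auto simp: decoded_at_def)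
  have R_nonneg: "0 \<le> R $ v" for v
    using R by (cases "v \<in> V"; cases v) (auto simp: rate_vectors_def)
  \<comment> \<open>Only positive rate sums get a test; \<open>agree\<close> below shows that the
    agreement sets of all competing tuples are among them.\<close>
  define \<F> where "\<F> = (\<lambda>z. {F. F \<subseteq> ?H z \<and> pa S F \<subseteq> F \<and> 0 < (\<Sum>v\<in>?H z - F. R $ v)})"
  \<comment> \<open>At the midpoint, the gap above the rate sum beats the number of competing tuples
    and the gap below \<open>info z F\<close> protects the transmitted one.\<close>
  define \<gamma> where "\<gamma> = (\<lambda>z F. ((\<Sum>v\<in>?H z - F. R $ v) + info z F) / 2)"
  define W where "W = (\<lambda>n v. {1..num_messages n (R $ v)})"
  have \<F>: "finite (\<F> z)" "F \<in> \<F> z \<Longrightarrow> F \<subseteq> ?H z" for z F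
    by (auto simp: \<F>_def)
  have \<gamma>: "(\<Sum>v\<in>?H z - F. R $ v) < \<gamma> z F" "\<gamma> z F < info z F" if "F \<in> \<F> z" for z F
    using less[of F z] that by (auto simp: \<F>_def \<gamma>_def)
  define ratio where "ratio = (\<lambda>z F (q, a, y).
    info_ratio (\<lambda>y. y z) (?H z) F q (restrict a (?H z)) (y z) * 2 powr (- \<gamma> z F))"
  have ex: "\<exists>s>0. measure_pmf.expectation joint (\<lambda>x. ratio z F x powr (- s)) < 1" if F: "F \<in> \<F> z" for z F
  proof (rule exists_negative_moment_lt_1[OF finite_joint])
    fix x assume "x \<in> set_pmf joint"
    then show "0 < ratio z F x"
      using info_ratio_pos[OF _ \<F>(2)[OF F]] by (cases x) (auto simp: ratio_def intro!: mult_pos_pos)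
  next
    \<comment> \<open>The factor \<open>2 powr (- \<gamma> z F)\<close> lowers the mean logarithm to
      \<open>ln 2\<close> times the positive difference
      \<open>info z F - \<gamma> z F\<close>.\<close>
    have "measure_pmf.expectation joint (\<lambda>x. ln (ratio z F x)) =
        measure_pmf.expectation joint (\<lambda>x. ln 2 * (case x of (q, a, y) \<Rightarrow>
          log 2 (info_ratio (\<lambda>y. y z) (?H z) F q (restrict a (?H z)) (y z))) - ln 2 * \<gamma> z F)"
    proof (intro integral_cong_AE)
      show "AE x in joint. ln (ratio z F x) = ln 2 * (case x of (q, a, y) \<Rightarrow>
          log 2 (info_ratio (\<lambda>y. y z) (?H z) F q (restrict a (?H z)) (y z))) - ln 2 * \<gamma> z F"
      proof (unfold AE_measure_pmf_iff, intro ballI)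
        fix x assume x: "x \<in> set_pmf joint"
        obtain q a y where [simp]: "x = (q, a, y)" by (cases x)
        have "0 < info_ratio (\<lambda>y. y z) (?H z) F q (restrict a (?H z)) (y z)"
          using info_ratio_pos[OF _ \<F>(2)[OF F], of q a y "\<lambda>y. y z"] x by simp
        then show "ln (ratio z F x) = ln 2 * (case x of (q, a, y) \<Rightarrow>
          log 2 (info_ratio (\<lambda>y. y z) (?H z) F q (restrict a (?H z)) (y z))) - ln 2 * \<gamma> z F"
          by (simp add: ratio_def ln_mult log_def ln_powr)
      qed
    qed auto
    also have "\<dots> = ln 2 * info z F - ln 2 * \<gamma> z F"
      unfolding info_def using finite_joint
      by (subst Bochner_Integration.integral_diff) (auto intro!: integrable_measure_pmf_finite)
    also have "\<dots> > 0" using \<gamma>(2)[OF F] by simp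
    finally show "0 < measure_pmf.expectation joint (\<lambda>x. ln (ratio z F x))" .
  qed
  define s where "s = (\<lambda>z F. SOME s. s > 0 \<and>
    measure_pmf.expectation joint (\<lambda>x. ratio z F x powr (- s)) < 1)"
  have s: "s z F > 0" "measure_pmf.expectation joint (\<lambda>x. ratio z F x powr (- s z F)) < 1"
    if "F \<in> \<F> z" for z F
    using someI_ex[OF ex[OF that]] by (simp_all add: s_def)
  define \<epsilon> where "\<epsilon> = (\<lambda>z F. measure_pmf.expectation joint (\<lambda>x. ratio z F x powr (- s z F)))"
  have \<epsilon>: "0 \<le> \<epsilon> z F" for z F
    unfolding \<epsilon>_def by (intro integral_nonneg_AE) auto
  define \<beta> where "\<beta> = (\<lambda>n z F. real (\<Prod>v\<in>?H z - F. card (W n v)) * 2 powr (- real n * \<gamma> z F))"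
  have \<beta>: "0 \<le> \<beta> n z F" for n z F
    unfolding \<beta>_def by (intro mult_nonneg_nonneg of_nat_0_le_iff powr_ge_zero)
  \<comment> \<open>Bound for all receivers together: \<open>\<epsilon>\<close> accounts for
    rejecting the transmitted tuple, \<open>\<beta>\<close> for accepting a wrong one.\<close>
  define B where "B = (\<lambda>n. (\<Sum>z\<in>UNIV. (\<Sum>F\<in>\<F> z. \<epsilon> z F ^ n) + (\<Sum>F\<in>\<F> z. \<beta> n z F)))"

  have agree: "agree (?H z) w w' \<in> \<F> z"
    if w: "w \<in> PiE V (W n)" and w': "w' \<in> PiE (?H z) (W n)" and ne: "w' \<noteq> restrict w (?H z)" for n z w w'
  proof -
    have "\<exists>v. w' v \<noteq> restrict w (?H z) v" using ne by (auto simp: fun_eq_iff)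
    then obtain v where v: "w' v \<noteq> restrict w (?H z) v" ..
    have vH: "v \<in> ?H z" using v PiE_arb[OF w', of v] by (auto simp: restrict_def split: if_splits)
    then have wv: "w v \<noteq> w' v" "w v \<in> W n v" "w' v \<in> W n v"
      using v w w' H(1)[of z] by auto
    \<comment> \<open>The message set at \<open>v\<close> has the two different elements
      \<open>w v\<close> and \<open>w' v\<close>.\<close>
    have "R $ v \<noteq> 0"
      using wv by (auto simp: W_def num_messages_0)
    then have "0 < R $ v" using R_nonneg[of v] by simp
    moreover have "v \<in> ?H z - agree (?H z) w w'"
      using vH wv by (auto simp: agree_def anc_def)
    ultimately have "0 < (\<Sum>v\<in>?H z - agree (?H z) w w'. R $ v)"
      using H(3) R_nonneg by (intro sum_pos2[of _ v]) auto
    moreover have "agree (?H z) w w' \<subseteq> ?H z" by (auto simp: agree_def)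
    ultimately show ?thesis
      using agree_closed[OF H(2), of z w w'] by (simp add: \<F>_def)
  qed

  have fail: "emeasure (block_law n (codebook (W n)) (\<lambda>(q, g). ch q (codewords g w)))
      (failure n (W n) \<F> \<gamma> z w) \<le> ennreal ((\<Sum>F\<in>\<F> z. \<epsilon> z F ^ n) + (\<Sum>F\<in>\<F> z. \<beta> n z F))"
    if w: "w \<in> PiE V (W n)" for n z w
  proof -
    let ?N = "block_law n (codebook (W n)) (\<lambda>(q, g). ch q (codewords g w))"
    let ?T = "{(C, y). \<not> passes n (\<lambda>y. y z) (?H z) (\<F> z) (\<gamma> z) C (\<lambda>t. y t z) (restrict w (?H z))}"
    let ?X = "{(C, y). \<exists>w'\<in>PiE (?H z) (W n). w' \<noteq> restrict w (?H z) \<and>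
          passes n (\<lambda>y. y z) (?H z) (\<F> z) (\<gamma> z) C (\<lambda>t. y t z) w'}"
    have W: "finite (W n v)" for v by (simp add: W_def)
    have "emeasure ?N (failure n (W n) \<F> \<gamma> z w) \<le> emeasure ?N ?T + emeasure ?N ?X"
      unfolding failure_def by (intro emeasure_subadditive) auto
    also have "\<dots> \<le> (\<Sum>F\<in>\<F> z. ennreal (\<epsilon> z F) ^ n) + (\<Sum>F\<in>\<F> z. ennreal (\<beta> n z F))"
    proof (rule add_mono)
      show "emeasure ?N ?T \<le> (\<Sum>F\<in>\<F> z. ennreal (\<epsilon> z F) ^ n)"
        using passes_true_bound[where n = n and \<rho> = "\<lambda>y. y z" and \<gamma> = "\<gamma> z",
          OF W H(1)[of z] H(2) w \<F>(1)[of z] \<F>(2) finite_joint s(1)]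
        by (simp add: \<epsilon>_def ratio_def case_prod_unfold)
      show "emeasure ?N ?X \<le> (\<Sum>F\<in>\<F> z. ennreal (\<beta> n z F))"
        using passes_wrong_bound[where n = n and \<rho> = "\<lambda>y. y z" and \<gamma> = "\<gamma> z",
          OF W H(1)[of z] H(2) w \<F>(1)[of z] agree[OF w]]
        by (simp add: \<beta>_def)
    qed
    also have "\<dots> = ennreal ((\<Sum>F\<in>\<F> z. \<epsilon> z F ^ n) + (\<Sum>F\<in>\<F> z. \<beta> n z F))"
      using \<epsilon> \<beta> by (simp add: ennreal_plus sum_nonneg ennreal_power)
    finally show ?thesis .
  qed

  \<comment> \<open>Averaging the sum over the receivers yields one codebook sequence that serves
    all of them; the slack \<open>1 / real (Suc n)\<close> pays for choosing it and vanishes in the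
    limit.\<close>
  have code: "\<exists>C. \<forall>z. \<forall>v\<in>?H z.
      error_prob V P R n (encoder C) (decoder n (W n) \<F> \<gamma> C) z v \<le> B n + 1 / real (Suc n)" for n
  proof -
    define Cs where "Cs = Pi_pmf {..<n} undefined (\<lambda>_. codebook (W n))"
    define M where "M = messages_pmf V R n"
    define err where "err = (\<lambda>C z. \<integral>\<^sup>+w. emeasure (transmit V P n (encoder C) w)
      {y. (C, y) \<in> failure n (W n) \<F> \<gamma> z w} \<partial>M)"
    have wM: "w \<in> PiE V (W n)" if "w \<in> set_pmf M" for w
    proof -
      have "{1..num_messages n r} \<noteq> {}" for r using num_messages_pos[of n r] by (auto simp: Suc_le_eq)
      then show ?thesis
        using that by (auto simp: M_def messages_pmf_def set_Pi_pmf PiE_dflt_def W_def PiE_def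
          Pi_def extensional_def)
    qed
    have "(\<integral>\<^sup>+C. (\<Sum>z\<in>UNIV. err C z) \<partial>Cs) = (\<Sum>z\<in>UNIV. \<integral>\<^sup>+C. err C z \<partial>Cs)"
      by (rule nn_integral_sum) auto
    also have "\<dots> \<le> (\<Sum>z\<in>UNIV. ennreal ((\<Sum>F\<in>\<F> z. \<epsilon> z F ^ n) + (\<Sum>F\<in>\<F> z. \<beta> n z F)))"
    proof (rule sum_mono)
      fix z
      have "(\<integral>\<^sup>+C. err C z \<partial>Cs) = (\<integral>\<^sup>+w. \<integral>\<^sup>+C. emeasure (transmit V P n (encoder C) w)
          {y. (C, y) \<in> failure n (W n) \<F> \<gamma> z w} \<partial>Cs \<partial>M)"
        unfolding err_def by (rule nn_integral_pmf_commute)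
      also have "\<dots> = (\<integral>\<^sup>+w. emeasure (block_law n (codebook (W n)) (\<lambda>(q, g). ch q (codewords g w)))
          (failure n (W n) \<F> \<gamma> z w) \<partial>M)"
        by (simp add: block_law_def Cs_def transmit_encoder vimage_def)
      also have "\<dots> \<le> (\<integral>\<^sup>+w. ennreal ((\<Sum>F\<in>\<F> z. \<epsilon> z F ^ n) + (\<Sum>F\<in>\<F> z. \<beta> n z F)) \<partial>M)"
        using fail wM by (intro nn_integral_mono_AE) (auto simp: AE_measure_pmf_iff)
      finally show "(\<integral>\<^sup>+C. err C z \<partial>Cs) \<le> ennreal ((\<Sum>F\<in>\<F> z. \<epsilon> z F ^ n) + (\<Sum>F\<in>\<F> z. \<beta> n z F))"
        by simp
    qed
    also have "\<dots> = ennreal (B n)"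
      unfolding B_def using \<epsilon> \<beta> by (intro sum_ennreal add_nonneg_nonneg sum_nonneg) auto
    finally have "\<exists>C. (\<Sum>z\<in>UNIV. err C z) \<le> ennreal (B n + 1 / real (Suc n))"
      by (rule ex_le_nn_integral_pmf) simp
    then obtain C where C: "(\<Sum>z\<in>UNIV. err C z) \<le> ennreal (B n + 1 / real (Suc n))" ..
    have B_nonneg: "0 \<le> B n + 1 / real (Suc n)"
      unfolding B_def using \<epsilon> \<beta> by (intro add_nonneg_nonneg sum_nonneg) auto
    have "error_prob V P R n (encoder C) (decoder n (W n) \<F> \<gamma> C) z v \<le> B n + 1 / real (Suc n)"
      if v: "v \<in> ?H z" for z v
    proof -
      let ?E = "{(w, y). decoder n (W n) \<F> \<gamma> C z v (\<lambda>t\<in>{..<n}. y t z) \<noteq> w v}"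
      have "emeasure (transmission_pmf V P R n (encoder C)) ?E =
          (\<integral>\<^sup>+w. emeasure (transmit V P n (encoder C) w)
            {y. decoder n (W n) \<F> \<gamma> C z v (\<lambda>t\<in>{..<n}. y t z) \<noteq> w v} \<partial>M)"
        by (simp add: transmission_pmf_def M_def vimage_def)
      also have "\<dots> \<le> err C z"
        unfolding err_def
      proof (intro nn_integral_mono_AE, unfold AE_measure_pmf_iff, intro ballI emeasure_mono)
        fix w assume "w \<in> set_pmf M"
        then show "{y. decoder n (W n) \<F> \<gamma> C z v (\<lambda>t\<in>{..<n}. y t z) \<noteq> w v}
            \<subseteq> {y. (C, y) \<in> failure n (W n) \<F> \<gamma> z w}"
          using decoder_correct[OF _ wM v] by blast
      qed auto
      also have "\<dots> \<le> (\<Sum>z\<in>UNIV. err C z)" by (rule member_le_sum) auto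
      also have "\<dots> \<le> ennreal (B n + 1 / real (Suc n))" by (rule C)
      finally show ?thesis
        using B_nonneg unfolding error_prob_def by (simp add: measure_pmf.emeasure_eq_measure)
    qed
    then show ?thesis by blast
  qed
  then obtain C where C: "\<And>n z v. v \<in> ?H z \<Longrightarrow>
      error_prob V P R n (encoder (C n)) (decoder n (W n) \<F> \<gamma> (C n)) z v \<le> B n + 1 / real (Suc n)"
    by metis

  have \<beta>_lim: "(\<lambda>n. \<beta> n z F) \<longlonglongrightarrow> 0" if F: "F \<in> \<F> z" for z F
  proof (rule tendsto_sandwich)
    \<comment> \<open>The exponent is negative since the threshold exceeds the rate sum; the power
      of 2 in the bound below comes from rounding the message counts.\<close>
    define d where "d = (\<Sum>v\<in>?H z - F. R $ v) - \<gamma> z F"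
    have d: "d < 0" using \<gamma>(1)[OF F] by (simp add: d_def)
    show "\<forall>\<^sub>F n in sequentially. 0 \<le> \<beta> n z F" by (simp add: \<beta>)
    have "\<beta> n z F \<le> 2 ^ card (?H z - F) * (2 powr d) ^ n" for n
    proof -
      have "real (\<Prod>v\<in>?H z - F. card (W n v)) \<le> (\<Prod>v\<in>?H z - F. 2 * 2 powr (real n * R $ v))"
        using num_messages_le[OF R_nonneg] by (simp add: W_def prod_mono)
      also have "\<dots> = 2 ^ card (?H z - F) * 2 powr (real n * (\<Sum>v\<in>?H z - F. R $ v))"
        by (simp add: prod.distrib powr_sum sum_distrib_left)
      finally have "\<beta> n z F \<le> 2 ^ card (?H z - F) * 2 powr (real n * (\<Sum>v\<in>?H z - F. R $ v))
          * 2 powr (- real n * \<gamma> z F)"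
        unfolding \<beta>_def by (rule mult_right_mono) auto
      also have "\<dots> = 2 ^ card (?H z - F) * (2 powr d) ^ n"
        by (simp add: powr_power d_def powr_add[symmetric] algebra_simps flip: powr_add)
      finally show ?thesis .
    qed
    then show "\<forall>\<^sub>F n in sequentially. \<beta> n z F \<le> 2 ^ card (?H z - F) * (2 powr d) ^ n" by simp
    have "2 powr d < (1::real)" using d powr_less_mono[of d 0 "2::real"] by simp
    then have "(\<lambda>n. (2 powr d) ^ n) \<longlonglongrightarrow> (0::real)" by (intro LIMSEQ_power_zero) auto
    then show "(\<lambda>n. 2 ^ card (?H z - F) * (2 powr d) ^ n) \<longlonglongrightarrow> 0"
      by (rule tendsto_mult_right_zero)
  qed auto
  have \<epsilon>_lim: "(\<lambda>n. \<epsilon> z F ^ n) \<longlonglongrightarrow> 0" if "F \<in> \<F> z" for z F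
    using \<epsilon>[of z F] s(2)[OF that] by (intro LIMSEQ_power_zero) (auto simp: \<epsilon>_def)
  have "B \<longlonglongrightarrow> (\<Sum>z\<in>UNIV. (\<Sum>F\<in>\<F> z. 0) + (\<Sum>F\<in>\<F> z. 0))"
    unfolding B_def using \<beta>_lim \<epsilon>_lim by (intro tendsto_sum tendsto_add) auto
  then have B_lim: "(\<lambda>n. B n + 1 / real (Suc n)) \<longlonglongrightarrow> 0"
    using tendsto_add[OF _ LIMSEQ_inverse_real_of_nat, of B 0] by (simp add: inverse_eq_divide)

  have fin: "finite {error_prob V P R n enc dec z v |z v. v \<in> ?H z}"
    for n and enc :: "('tx, 'rx, 'x) encoders" and dec
  proof -
    have "{error_prob V P R n enc dec z v |z v. v \<in> ?H z} \<subseteq> (\<lambda>(z, v). error_prob V P R n enc dec z v) ` UNIV"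
      by auto
    then show ?thesis by (rule finite_subset) simp
  qed
  have "0 \<le> max_error_prob V P R n (encoder (C n)) (decoder n (W n) \<F> \<gamma> (C n))" for n
    unfolding max_error_prob_def using fin by (intro Max_ge) auto
  moreover have "0 \<le> B n + 1 / real (Suc n)" for n
    unfolding B_def using \<epsilon> \<beta> by (intro add_nonneg_nonneg sum_nonneg) auto
  then have "max_error_prob V P R n (encoder (C n)) (decoder n (W n) \<F> \<gamma> (C n)) \<le> B n + 1 / real (Suc n)" for n
    unfolding max_error_prob_def using fin C by (subst Max_le_iff) auto
  ultimately have "(\<lambda>n. max_error_prob V P R n (encoder (C n)) (decoder n (W n) \<F> \<gamma> (C n))) \<longlonglongrightarrow> 0"
    by (intro tendsto_sandwich[OF _ _ tendsto_const B_lim]) auto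
  moreover have "valid_encoders A n (encoder (C n))" for n
    by (simp add: valid_encoders_def encoder_def inp_in)
  ultimately show ?thesis
    unfolding achievable_def using R
    by (intro conjI exI[of _ "\<lambda>n. encoder (C n)"] exI[of _ "\<lambda>n. decoder n (W n) \<F> \<gamma> (C n)"]) auto
qed

end

section \<open>Laws of simple random variables\<close>

lemma simple_function_tuple:
  assumes "finite I" "\<And>i. i \<in> I \<Longrightarrow> simple_function M (g i)"
  shows "simple_function M (\<lambda>\<omega>. \<lambda>i\<in>I. g i \<omega>)"
  unfolding simple_function_def
proof safe
  have "(\<lambda>\<omega>. \<lambda>i\<in>I. g i \<omega>) ` space M \<subseteq> PiE I (\<lambda>i. g i ` space M)" by auto
  then show "finite ((\<lambda>\<omega>. \<lambda>i\<in>I. g i \<omega>) ` space M)"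
    by (rule finite_subset) (use assms in \<open>auto intro!: finite_PiE simp: simple_function_def\<close>)
  fix \<omega> assume "\<omega> \<in> space M"
  have "(\<lambda>\<omega>. \<lambda>i\<in>I. g i \<omega>) -` {\<lambda>i\<in>I. g i \<omega>} \<inter> space M =
      {\<omega>' \<in> space M. \<forall>i\<in>I. \<omega>' \<in> g i -` {g i \<omega>} \<inter> space M}"
    by (auto simp: restrict_def fun_eq_iff) metis
  also have "\<dots> \<in> sets M"
  proof (intro sets.sets_Collect_finite_All assms(1))
    fix i assume "i \<in> I"
    then have "g i -` {g i \<omega>} \<inter> space M \<in> sets M"
      using assms(2) \<open>\<omega> \<in> space M\<close> by (auto simp: simple_function_def)
    moreover have "{\<omega>' \<in> space M. \<omega>' \<in> g i -` {g i \<omega>} \<inter> space M} = g i -` {g i \<omega>} \<inter> space M"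
      by auto
    ultimately show "{\<omega>' \<in> space M. \<omega>' \<in> g i -` {g i \<omega>} \<inter> space M} \<in> sets M" by simp
  qed
  finally show "(\<lambda>\<omega>. \<lambda>i\<in>I. g i \<omega>) -` {\<lambda>i\<in>I. g i \<omega>} \<inter> space M \<in> sets M" .
qed

lemma simple_function_count_space:
  assumes "f \<in> measurable M (count_space B)" "finite B"
  shows "simple_function M f"
  unfolding simple_function_def
proof safe
  show "finite (f ` space M)"
    using assms measurable_space[OF assms(1)] by (auto intro: finite_subset[of _ B])
  fix \<omega> assume "\<omega> \<in> space M"
  then show "f -` {f \<omega>} \<inter> space M \<in> sets M"
    using measurable_space[OF assms(1), of \<omega>] by (intro measurable_sets[OF assms(1)]) auto
qed

text \<open>With finitely many values, the uncharged values and the points outside the range form a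
  null set, so the image measure is discrete.\<close>

lemma (in prob_space) ex_pmf_of_simple_function:
  assumes T: "simple_function M T"
  shows "\<exists>p. set_pmf p \<subseteq> T ` space M \<and> (\<forall>E. measure_pmf.prob p E = \<P>(\<omega> in M. T \<omega> \<in> E))"
proof -
  let ?D = "distr M (count_space UNIV) T"
  have meas: "T \<in> measurable M (count_space UNIV)" using T by (rule measurable_simple_function)
  have D: "measure ?D E = \<P>(\<omega> in M. T \<omega> \<in> E)" for E
    using meas by (subst measure_distr) (auto simp: vimage_def Int_def conj_commute)
  have "prob_space ?D" using meas by (rule prob_space_distr)
  moreover have "AE x in ?D. measure ?D {x} \<noteq> 0"
  proof -
    have fin: "finite (T ` space M)" using T by (simp add: simple_function_def)
    let ?N = "{x \<in> T ` space M. measure ?D {x} = 0} \<union> - T ` space M"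
    have "measure ?D {x \<in> T ` space M. measure ?D {x} = 0} = (\<Sum>x\<in>{x \<in> T ` space M. measure ?D {x} = 0}. measure ?D {x})"
      using fin \<open>prob_space ?D\<close> by (intro finite_measure.finite_measure_eq_sum_singleton)
        (auto simp: prob_space_def)
    also have "\<dots> = 0" by (intro sum.neutral) auto
    finally have 1: "{x \<in> T ` space M. measure ?D {x} = 0} \<in> null_sets ?D"
      using \<open>prob_space ?D\<close>
      by (auto simp: null_sets_def finite_measure.emeasure_eq_measure prob_space_def)
    have "measure ?D (- T ` space M) = measure M {}"
      unfolding D by (rule arg_cong[where f="measure M"]) auto
    then have 2: "- T ` space M \<in> null_sets ?D"
      using \<open>prob_space ?D\<close>
      by (auto simp: null_sets_def finite_measure.emeasure_eq_measure prob_space_def)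
    show ?thesis
      by (rule AE_I'[OF null_sets.Un[OF 1 2]]) auto
  qed
  ultimately have eq: "measure_pmf (Abs_pmf ?D) = ?D"
    by (intro Abs_pmf_inverse) auto
  have "set_pmf (Abs_pmf ?D) \<subseteq> T ` space M"
  proof
    fix x assume "x \<in> set_pmf (Abs_pmf ?D)"
    then have "measure (measure_pmf (Abs_pmf ?D)) {x} \<noteq> 0"
      by (simp add: measure_pmf_single pmf_eq_0_set_pmf)
    then have "\<P>(\<omega> in M. T \<omega> \<in> {x}) \<noteq> 0" unfolding eq D .
    moreover have "\<P>(\<omega> in M. T \<omega> \<in> {x}) = measure M {}" if "x \<notin> T ` space M"
      using that by (intro arg_cong[where f="measure M"]) auto
    ultimately show "x \<in> T ` space M" by auto
  qed
  moreover have "measure_pmf.prob (Abs_pmf ?D) E = \<P>(\<omega> in M. T \<omega> \<in> E)" for E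
    unfolding eq by (rule D)
  ultimately show ?thesis by blast
qed

text \<open>Writes conditional mutual information as the mean of an information density, the shape
  of \<open>info\<close>.\<close>

lemma (in information_space) conditional_mutual_information_pmf:
  assumes p: "set_pmf p \<subseteq> T ` space M" "\<And>E. measure_pmf.prob p E = \<P>(\<omega> in M. T \<omega> \<in> E)"
    and T: "simple_function M T"
  shows "\<I>((\<lambda>\<omega>. x (T \<omega>)) ; (\<lambda>\<omega>. y (T \<omega>)) | (\<lambda>\<omega>. z (T \<omega>))) =
    measure_pmf.expectation p (\<lambda>s. log b
      (measure_pmf.prob p {s'. x s' = x s \<and> y s' = y s \<and> z s' = z s} * measure_pmf.prob p {s'. z s' = z s} /
       (measure_pmf.prob p {s'. x s' = x s \<and> z s' = z s} * measure_pmf.prob p {s'. y s' = y s \<and> z s' = z s})))"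
proof -
  have sd: "simple_distributed M (\<lambda>\<omega>. g (T \<omega>)) (\<lambda>a. measure_pmf.prob p {s'. g s' = a})" for g :: "'b \<Rightarrow> 'range"
    using simple_function_compose2[OF T T, of "\<lambda>s _. g s"]
    by (intro simple_distributedI) (auto simp: p(2) intro!: arg_cong[where f="measure M"])
  let ?g = "\<lambda>(a, c, d). log b
      (measure_pmf.prob p {s'. (x s', y s', z s') = (a, c, d)} /
       (measure_pmf.prob p {s'. (x s', z s') = (a, d)} *
        (measure_pmf.prob p {s'. (y s', z s') = (c, d)} / measure_pmf.prob p {s'. z s' = d})))"
  let ?\<pi> = "\<lambda>s. (x s, y s, z s)"
  have "\<I>((\<lambda>\<omega>. x (T \<omega>)) ; (\<lambda>\<omega>. y (T \<omega>)) | (\<lambda>\<omega>. z (T \<omega>))) =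
      (\<Sum>a\<in>(\<lambda>\<omega>. ?\<pi> (T \<omega>)) ` space M. measure_pmf.prob p {s'. ?\<pi> s' = a} * ?g a)"
    by (subst conditional_mutual_information_eq[OF sd[of z] sd[of "\<lambda>s. (y s, z s)"]
        sd[of "\<lambda>s. (x s, z s)"] sd[of "\<lambda>s. (x s, y s, z s)"]]) (auto intro!: sum.cong)
  also have "\<dots> = (\<Sum>a\<in>(\<lambda>\<omega>. ?\<pi> (T \<omega>)) ` space M. ?g a * pmf (map_pmf ?\<pi> p) a)"
    by (intro sum.cong refl) (simp add: pmf_map vimage_def mult.commute)
  also have "\<dots> = measure_pmf.expectation (map_pmf ?\<pi> p) ?g"
  proof (rule integral_measure_pmf_real[symmetric])
    have img: "(\<lambda>\<omega>. ?\<pi> (T \<omega>)) ` space M = ?\<pi> ` T ` space M"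
      by (simp add: image_image)
    show "finite ((\<lambda>\<omega>. ?\<pi> (T \<omega>)) ` space M)"
      unfolding img using simple_functionD(1)[OF T] by (rule finite_imageI)
    fix a assume "a \<in> set_pmf (map_pmf ?\<pi> p)"
    then show "a \<in> (\<lambda>\<omega>. ?\<pi> (T \<omega>)) ` space M"
      unfolding img using p(1) by auto
  qed
  also have "\<dots> = measure_pmf.expectation p (\<lambda>s. ?g (?\<pi> s))"
    by simp
  finally show ?thesis by simp
qed

lemma cond_pmf_prob:
  assumes "measure_pmf.prob p E \<noteq> 0"
  shows "set_pmf p \<inter> E \<noteq> {}" "measure_pmf.prob (cond_pmf p E) D = measure_pmf.prob p (E \<inter> D) / measure_pmf.prob p E"
proof -
  show ne: "set_pmf p \<inter> E \<noteq> {}" using assms measure_pmf_zero_iff[of p E] by auto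
  show "measure_pmf.prob (cond_pmf p E) D = measure_pmf.prob p (E \<inter> D) / measure_pmf.prob p E"
    unfolding cond_pmf.rep_eq[OF ne] using assms
    by (subst measure_uniform_measure) (auto simp: measure_pmf.emeasure_eq_measure)
qed

lemma scaled_limit_in_closure:
  fixes x :: "'a :: real_normed_vector"
  assumes "\<And>c. 0 < c \<Longrightarrow> c < 1 \<Longrightarrow> c *\<^sub>R x \<in> X"
  shows "x \<in> closure X"
proof -
  \<comment> \<open>The shift by two keeps \<open>c n\<close> strictly between 0 and 1, also for n =
    0.\<close>
  define c where "c = (\<lambda>n. 1 - inverse (real (Suc (Suc n))))"
  have "c \<longlonglongrightarrow> 1 - 0"
    unfolding c_def by (intro tendsto_diff tendsto_const LIMSEQ_Suc[OF LIMSEQ_inverse_real_of_nat])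
  then have "(\<lambda>n. c n *\<^sub>R x) \<longlonglongrightarrow> 1 *\<^sub>R x"
    by (intro tendsto_scaleR tendsto_const) simp
  moreover have "c n *\<^sub>R x \<in> X" for n
    by (rule assms) (simp_all add: c_def field_simps)
  ultimately show ?thesis
    unfolding closure_sequential by (intro exI[of _ "\<lambda>n. c n *\<^sub>R x"]) simp
qed

section \<open>From the given random variables to random codes\<close>

theorem theorem2:
  fixes V :: "('tx::finite, 'rx::finite) node set"
    and S :: "(('tx, 'rx) node \<times> ('tx, 'rx) node) set"
    and A :: "'tx \<Rightarrow> 'x set" and B :: "'rx \<Rightarrow> 'y set"
    and P :: "('tx \<Rightarrow> 'x) \<Rightarrow> ('rx \<Rightarrow> 'y) pmf"
    and M :: "'w measure"
    and Q :: "'w \<Rightarrow> 'q" and U :: "('tx, 'rx) node \<Rightarrow> 'w \<Rightarrow> 'u"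
    and X :: "'tx \<Rightarrow> 'w \<Rightarrow> 'x" and Y :: "'rx \<Rightarrow> 'w \<Rightarrow> 'y"
    and f :: "'tx \<Rightarrow> (('tx, 'rx) node \<Rightarrow> 'u) \<Rightarrow> 'q \<Rightarrow> 'x"
  assumes "message_allocation V"
    and "discrete_channel A B P"
    and "superposition_graph V S"
    and "prob_space M"
    and "simple_function M Q"
    and "\<And>v. v \<in> V \<Longrightarrow> simple_function M (U v)"
    and "superposition_factorization M V S Q U"
    and "\<And>k. X k \<in> measurable M (count_space (A k))"
    and "\<And>k \<omega>. \<omega> \<in> space M \<Longrightarrow> X k \<omega> = f k (\<lambda>v\<in>known_at V k. U v \<omega>) (Q \<omega>)"
    and "\<And>z. Y z \<in> measurable M (count_space (B z))"
    and "channel_output M V P Q U X Y"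
  shows "superposition_region M V S Q U Y \<subseteq> capacity_region V A P"
proof
  note channel = assms(2) and graph = assms(3) and factorization = assms(7)
    and X_meas = assms(8) and X_eq = assms(9) and channel_out = assms(11)
  interpret prob_space M by fact
  interpret information_space M 2 by standard simp
  have A: "A k \<noteq> {}" and B: "finite (B z)" for k z
    using channel by (auto simp: discrete_channel_def)
  have S: "S \<subseteq> V \<times> V" "trans S" "acyclic S"
    using graph by (auto simp: superposition_graph_def)

  \<comment> \<open>The inputs are left out because \<open>Q\<close> and \<open>U\<close> determine
    them.\<close>
  define T where "T = (\<lambda>\<omega>. (Q \<omega>, \<lambda>v\<in>V. U v \<omega>, \<lambda>z. Y z \<omega>))"
  have "simple_function M (\<lambda>\<omega>. \<lambda>z\<in>UNIV. Y z \<omega>)"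
    using simple_function_count_space[OF assms(10) B] by (intro simple_function_tuple) auto
  then have "simple_function M (\<lambda>\<omega> z. Y z \<omega>)" by (simp add: restrict_def)
  moreover have "simple_function M (\<lambda>\<omega>. \<lambda>v\<in>V. U v \<omega>)"
    using assms(6) by (intro simple_function_tuple) auto
  ultimately have T: "simple_function M T"
    unfolding T_def using assms(5) by (auto intro!: simple_function_Pair)
  then obtain p where p: "set_pmf p \<subseteq> T ` space M"
    "\<And>E. measure_pmf.prob p E = \<P>(\<omega> in M. T \<omega> \<in> E)"
    using ex_pmf_of_simple_function by blast
  have fin_p: "finite (set_pmf p)"
    using p(1) simple_functionD(1)[OF T] by (rule finite_subset)

  define J where "J = map_pmf (\<lambda>(q, u, y). (q, u)) p"
  define E where "E = (\<lambda>v q u. {(q', u'). (\<forall>a\<in>pa S {v}. u' a = u a) \<and> q' = (q :: 'q)} :: ('q \<times> (('tx, 'rx) node \<Rightarrow> 'u)) set)"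
  \<comment> \<open>The law of \<open>U v\<close> given its parents and \<open>Q\<close>, read off
    the joint law \<open>J\<close>; an impossible condition gets an arbitrary value.\<close>
  define \<kappa> where "\<kappa> = (\<lambda>v q u. if set_pmf J \<inter> E v q u = {} then return_pmf undefined
    else map_pmf (\<lambda>(q, u). u v) (cond_pmf J (E v q u)))"
  \<comment> \<open>\<open>f\<close> may leave the alphabet at arguments that never occur; any
    letter of the alphabet serves there, which makes every encoder valid.\<close>
  define inp where "inp = (\<lambda>k q u. if f k u q \<in> A k then f k u q else (SOME x. x \<in> A k))"
  define ch where "ch = (\<lambda>q u. P (\<lambda>k. inp k q (restrict u (known_at V k))))"

  have J: "measure_pmf.prob J D = \<P>(\<omega> in M. (Q \<omega>, \<lambda>v\<in>V. U v \<omega>) \<in> D)" for D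
    unfolding J_def by (simp add: p(2) T_def vimage_def case_prod_unfold)
  have E_cong: "E v q u = E v q u'" if "\<And>a. a \<in> pa S {v} \<Longrightarrow> u a = u' a" for v q u u'
    using that by (auto simp: E_def)
  interpret C: superposition_channel S V \<kappa> "map_pmf fst p" ch
  proof
    show "\<kappa> v q u = \<kappa> v q u'" if u: "\<And>a. a \<in> pa S {v} \<Longrightarrow> u a = u' a" for v q u u'
    proof -
      have "E v q u = E v q u'" by (rule E_cong) (rule u)
      then show ?thesis by (simp add: \<kappa>_def)
    qed
  qed (use S in auto)

  have pa_V: "pa S V \<subseteq> V" "pa S {v} \<subseteq> V" for v using S(1) by (auto simp: pa_def)
  \<comment> \<open>One law dominates the other pointwise and both have mass one, so null conditioning events need no
    separate treatment.\<close>
  have law_V: "C.law V = J"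
  proof (rule ccontr)
    assume "C.law V \<noteq> J"
    then obtain q u where less: "pmf (C.law V) (q, u) < pmf J (q, u)"
      using pmf_neq_exists_less[of "C.law V" J] by auto
    have "(q, u) \<in> set_pmf J"
      using less le_less_trans[OF pmf_nonneg less] by (simp add: set_pmf_iff)
    then have ext: "u \<in> extensional V"
      using p(1) by (auto simp: J_def T_def)
    then have u_eq: "(\<lambda>v\<in>V. U v \<omega>) = u \<longleftrightarrow> (\<forall>v\<in>V. U v \<omega> = u v)" for \<omega>
      by (auto simp: extensional_def restrict_def fun_eq_iff)
    have cond: "\<P>(\<omega> in M. U v \<omega> = u v \<bar> (\<forall>a\<in>pa S {v}. U a \<omega> = u a) \<and> Q \<omega> = q) \<le> pmf (\<kappa> v q u) (u v)"
      if v: "v \<in> V" for v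
    proof (cases "measure_pmf.prob J (E v q u) = 0")
      case True
      have "\<P>(\<omega> in M. (\<forall>a\<in>pa S {v}. U a \<omega> = u a) \<and> Q \<omega> = q) = measure_pmf.prob J (E v q u)"
        unfolding J E_def using pa_V(2)[of v] by (intro arg_cong[where f="measure M"]) auto
      then show ?thesis using True by (simp add: cond_prob_def)
    next
      case False
      have "pmf (\<kappa> v q u) (u v) = measure_pmf.prob (cond_pmf J (E v q u)) {(q', u'). u' v = u v}"
        using cond_pmf_prob(1)[OF False] by (simp add: \<kappa>_def pmf_map vimage_def case_prod_unfold)
      also have "\<dots> = measure_pmf.prob J (E v q u \<inter> {(q', u'). u' v = u v}) / measure_pmf.prob J (E v q u)"
        by (rule cond_pmf_prob(2)[OF False])
      also have "measure_pmf.prob J (E v q u \<inter> {(q', u'). u' v = u v}) =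
          \<P>(\<omega> in M. U v \<omega> = u v \<and> (\<forall>a\<in>pa S {v}. U a \<omega> = u a) \<and> Q \<omega> = q)"
        unfolding J E_def using pa_V(2)[of v] v by (intro arg_cong[where f="measure M"]) auto
      also have "measure_pmf.prob J (E v q u) = \<P>(\<omega> in M. (\<forall>a\<in>pa S {v}. U a \<omega> = u a) \<and> Q \<omega> = q)"
        unfolding J E_def using pa_V(2)[of v] by (intro arg_cong[where f="measure M"]) auto
      finally show ?thesis by (simp add: cond_prob_def)
    qed
    have "pmf J (q, u) = \<P>(\<omega> in M. Q \<omega> = q \<and> (\<forall>v\<in>V. U v \<omega> = u v))"
      using J[of "{(q, u)}"] by (simp add: measure_pmf_single u_eq)
    also have "\<dots> = \<P>(\<omega> in M. Q \<omega> = q) *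
        (\<Prod>v\<in>V. \<P>(\<omega> in M. U v \<omega> = u v \<bar> (\<forall>a\<in>pa S {v}. U a \<omega> = u a) \<and> Q \<omega> = q))"
      using factorization by (simp add: superposition_factorization_def)
    also have "\<dots> \<le> \<P>(\<omega> in M. Q \<omega> = q) * (\<Prod>v\<in>V. pmf (\<kappa> v q u) (u v))"
      using cond by (intro mult_left_mono prod_mono) (auto simp: cond_prob_def)
    also have "\<P>(\<omega> in M. Q \<omega> = q) = pmf (map_pmf fst p) q"
      by (simp add: pmf_map p(2) T_def vimage_def)
    also have "pmf (map_pmf fst p) q * (\<Prod>v\<in>V. pmf (\<kappa> v q u) (u v)) = pmf (C.law V) (q, u)"
      using ext pa_V by (subst C.pmf_law) auto
    finally show False using less by simp
  qed

  have joint: "C.joint = p"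
  proof (rule pmf_eqI)
    fix s :: "'q \<times> (('tx, 'rx) node \<Rightarrow> 'u) \<times> ('rx \<Rightarrow> 'y)"
    obtain q u y where s: "s = (q, u, y)" by (cases s)
    have Js: "pmf J (q, u) = \<P>(\<omega> in M. Q \<omega> = q \<and> (\<lambda>v\<in>V. U v \<omega>) = u)"
      using J[of "{(q, u)}"] by (simp add: measure_pmf_single)
    have ps: "pmf p s = \<P>(\<omega> in M. Q \<omega> = q \<and> (\<lambda>v\<in>V. U v \<omega>) = u \<and> (\<forall>z. Y z \<omega> = y z))"
      using p(2)[of "{s}"] by (simp add: measure_pmf_single s T_def fun_eq_iff)
    show "pmf C.joint s = pmf p s"
    \<comment> \<open>Values attained nowhere have empty events on both sides; at attained ones the
      inputs are the fixed tuple \<open>x\<close> and the channel law applies.\<close>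
    proof (cases "\<exists>\<omega>0\<in>space M. Q \<omega>0 = q \<and> (\<lambda>v\<in>V. U v \<omega>0) = u")
      case False
      then have "{\<omega> \<in> space M. Q \<omega> = q \<and> (\<lambda>v\<in>V. U v \<omega>) = u} = {}"
        "{\<omega> \<in> space M. Q \<omega> = q \<and> (\<lambda>v\<in>V. U v \<omega>) = u \<and> (\<forall>z. Y z \<omega> = y z)} = {}"
        by auto
      then have "pmf J (q, u) = 0" "pmf p s = 0"
        unfolding Js ps by (simp_all only: measure_empty)
      then show ?thesis by (simp add: s C.pmf_joint law_V)
    next
      case True
      then have ext: "u \<in> extensional V" by auto
      then have u_eq: "(\<lambda>v\<in>V. U v \<omega>) = u \<longleftrightarrow> (\<forall>v\<in>V. U v \<omega> = u v)" for \<omega>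
        by (auto simp: extensional_def restrict_def fun_eq_iff)
      define x where "x = (\<lambda>k. inp k q (restrict u (known_at V k)))"
      have X: "X k \<omega> = x k" if \<omega>: "\<omega> \<in> space M" "Q \<omega> = q" "\<forall>v\<in>V. U v \<omega> = u v" for k \<omega>
      proof -
        have "restrict u (known_at V k) = (\<lambda>v\<in>known_at V k. U v \<omega>)"
          using \<omega>(3) by (auto simp: restrict_def known_at_def fun_eq_iff)
        then have "X k \<omega> = f k (restrict u (known_at V k)) q"
          using X_eq[OF \<omega>(1), of k] \<omega>(2) by simp
        moreover have "X k \<omega> \<in> A k" using measurable_space[OF X_meas \<omega>(1)] by simp
        ultimately show ?thesis by (simp add: x_def inp_def)
      qed
      have "pmf p s = \<P>(\<omega> in M. Q \<omega> = q \<and> (\<forall>v\<in>V. U v \<omega> = u v) \<and> (\<forall>k. X k \<omega> = x k) \<and> (\<forall>z. Y z \<omega> = y z))"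
        unfolding ps u_eq using X by (intro arg_cong[where f="measure M"]) blast
      also have "\<dots> = \<P>(\<omega> in M. Q \<omega> = q \<and> (\<forall>v\<in>V. U v \<omega> = u v) \<and> (\<forall>k. X k \<omega> = x k)) * pmf (P x) y"
        using channel_out by (simp add: channel_output_def)
      also have "\<P>(\<omega> in M. Q \<omega> = q \<and> (\<forall>v\<in>V. U v \<omega> = u v) \<and> (\<forall>k. X k \<omega> = x k)) = pmf J (q, u)"
        unfolding Js u_eq using X by (intro arg_cong[where f="measure M"]) blast
      also have "P x = ch q u" by (simp add: ch_def x_def)
      finally show ?thesis by (simp add: s C.pmf_joint law_V)
    qed
  qed

  interpret N: superposition_network S V \<kappa> "map_pmf fst p" ch A P inp
  proof
    show "inp k q u \<in> A k" for k q u
      using A[of k] by (auto simp: inp_def some_in_eq)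
  qed (use graph fin_p joint in \<open>auto simp: ch_def\<close>)

  have info: "cond_mutual_info M (Y z) (\<lambda>\<omega>. \<lambda>v \<in> decoded_at V z - F. U v \<omega>) (\<lambda>\<omega>. (\<lambda>v \<in> F. U v \<omega>, Q \<omega>)) = N.info z F"
    if F: "F \<subseteq> decoded_at V z" for z F
  proof -
    let ?H = "decoded_at V z"
    have H: "?H \<subseteq> V" by (auto simp: decoded_at_def)
    let ?x = "\<lambda>(q, u, y). y z" and ?y = "\<lambda>(q, u, y). restrict u (?H - F)" and ?z = "\<lambda>(q, u, y). (restrict u F, q)"
    have eqs: "Y z = (\<lambda>\<omega>. ?x (T \<omega>))" "(\<lambda>\<omega>. \<lambda>v \<in> ?H - F. U v \<omega>) = (\<lambda>\<omega>. ?y (T \<omega>))"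
      "(\<lambda>\<omega>. (\<lambda>v \<in> F. U v \<omega>, Q \<omega>)) = (\<lambda>\<omega>. ?z (T \<omega>))"
      using F H by (auto simp: T_def restrict_def fun_eq_iff)
    \<comment> \<open>The symbols on \<open>F\<close> and on the rest of \<open>?H\<close> together
      amount to those on \<open>?H\<close>, which matches the events with the laws in
      \<open>info_ratio\<close>.\<close>
    have split: "restrict u ?H = restrict u' ?H \<longleftrightarrow> restrict u F = restrict u' F \<and> restrict u (?H - F) = restrict u' (?H - F)"
      for u u' :: "('tx, 'rx) node \<Rightarrow> 'u"
      using F unfolding restrict_def fun_eq_iff by (smt (verit, best) DiffD1 DiffI subsetD)
    have HF: "?H \<inter> F = F" using F by auto
    have "cond_mutual_info M (Y z) (\<lambda>\<omega>. \<lambda>v \<in> ?H - F. U v \<omega>) (\<lambda>\<omega>. (\<lambda>v \<in> F. U v \<omega>, Q \<omega>)) =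
      measure_pmf.expectation p (\<lambda>s. log 2
      (measure_pmf.prob p {s'. ?x s' = ?x s \<and> ?y s' = ?y s \<and> ?z s' = ?z s} * measure_pmf.prob p {s'. ?z s' = ?z s} /
       (measure_pmf.prob p {s'. ?x s' = ?x s \<and> ?z s' = ?z s} * measure_pmf.prob p {s'. ?y s' = ?y s \<and> ?z s' = ?z s})))"
      unfolding eqs by (rule conditional_mutual_information_pmf[OF p T])
    also have "\<dots> = N.info z F"
      unfolding N.info_def joint
    proof (intro Bochner_Integration.integral_cong refl)
      fix s :: "'q \<times> (('tx, 'rx) node \<Rightarrow> 'u) \<times> ('rx \<Rightarrow> 'y)"
      obtain q u y where s: "s = (q, u, y)" by (cases s)
      have "measure_pmf.prob p {s'. ?x s' = y z \<and> ?y s' = restrict u (?H - F) \<and> ?z s' = (restrict u F, q)} =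
          pmf (C.law_out (\<lambda>y. y z) ?H) (q, restrict u ?H, y z)"
        unfolding C.law_out_def joint pmf_map
        by (intro arg_cong[where f="measure_pmf.prob p"]) (auto simp: split simp del: restrict_apply)
      moreover have "measure_pmf.prob p {s'. ?z s' = (restrict u F, q)} = pmf (C.law F) (q, restrict u F)"
        unfolding C.law_def joint pmf_map by (intro arg_cong[where f="measure_pmf.prob p"]) auto
      moreover have "measure_pmf.prob p {s'. ?x s' = y z \<and> ?z s' = (restrict u F, q)} =
          pmf (C.law_out (\<lambda>y. y z) F) (q, restrict u F, y z)"
        unfolding C.law_out_def joint pmf_map by (intro arg_cong[where f="measure_pmf.prob p"]) auto
      moreover have "measure_pmf.prob p {s'. ?y s' = restrict u (?H - F) \<and> ?z s' = (restrict u F, q)} =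
          pmf (C.law ?H) (q, restrict u ?H)"
        unfolding C.law_def joint pmf_map
        by (intro arg_cong[where f="measure_pmf.prob p"]) (auto simp: split simp del: restrict_apply)
      ultimately show "log 2
      (measure_pmf.prob p {s'. ?x s' = ?x s \<and> ?y s' = ?y s \<and> ?z s' = ?z s} *
         measure_pmf.prob p {s'. ?z s' = ?z s} /
       (measure_pmf.prob p {s'. ?x s' = ?x s \<and> ?z s' = ?z s} *
         measure_pmf.prob p {s'. ?y s' = ?y s \<and> ?z s' = ?z s})) =
        (case s of (q, a, y) \<Rightarrow> log 2 (C.info_ratio (\<lambda>y. y z) ?H F q (restrict a ?H) (y z)))"
        by (simp add: s C.info_ratio_def restrict_restrict HF mult.commute)
    qed
    finally show ?thesis .
  qed

  fix R assume R: "R \<in> superposition_region M V S Q U Y"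
  have "c *\<^sub>R R \<in> convex hull {R. achievable V A P R}" if c: "0 < c" "c < 1" for c
  proof -
    have "achievable V A P (c *\<^sub>R R)"
    proof (rule N.achievable_interior)
      show "c *\<^sub>R R \<in> rate_vectors V"
        using R c by (auto simp: superposition_region_def rate_vectors_def)
    next
      fix z F
      assume F: "F \<subseteq> decoded_at V z" "pa S F \<subseteq> F"
        and pos: "0 < (\<Sum>v\<in>decoded_at V z - F. (c *\<^sub>R R) $ v)"
      have eq: "(\<Sum>v\<in>decoded_at V z - F. (c *\<^sub>R R) $ v) = c * (\<Sum>v\<in>decoded_at V z - F. R $ v)"
        by (simp add: sum_distrib_left)
      have "0 < (\<Sum>v\<in>decoded_at V z - F. R $ v)"
        using pos c unfolding eq by (simp add: zero_less_mult_iff)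
      \<comment> \<open>Scaling makes the bound strict because the rate sum is positive.\<close>
      then have "c * (\<Sum>v\<in>decoded_at V z - F. R $ v) < (\<Sum>v\<in>decoded_at V z - F. R $ v)"
        using c by simp
      also have "\<dots> \<le> cond_mutual_info M (Y z) (\<lambda>\<omega>. \<lambda>v \<in> decoded_at V z - F. U v \<omega>) (\<lambda>\<omega>. (\<lambda>v \<in> F. U v \<omega>, Q \<omega>))"
        using R F by (simp add: superposition_region_def)
      also have "\<dots> = N.info z F" by (rule info[OF F(1)])
      finally show "(\<Sum>v\<in>decoded_at V z - F. (c *\<^sub>R R) $ v) < N.info z F"
        unfolding eq .
    qed
    then show ?thesis by (simp add: hull_inc)
  qed
  then show "R \<in> capacity_region V A P"
    unfolding capacity_region_def by (rule scaled_limit_in_closure)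
qed

end
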